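(* Let $X$ and $Y$ be totally ordered sets, each of size at least $4$, and let $F : [0,\infty) \to \mathbb{R}$. The operator $C_F : K \mapsto F \circ K$ maps the set of totally non-negative kernels on $X \times Y$ of any fixed order at least $4$ to itself if and only if $F$ is constant, so that $F(x) = c$, or linear, so that $F(x) = cx$, with $c \geq 0$. The same holds if totally non-negative kernels are replaced by totally positive kernels of any fixed order at least $4$, now with the requirement that $c > 0$.
   Context: A kernel on $X \times Y$ is a function $K : X \times Y \to \mathbb{R}$. For $p \in \mathbb{N}$, $K$ is totally non-negative of order $p$ (respectively totally positive of order $p$) if for every $n \in \{1,\dots,p\}$ and all $x_1 < \cdots < x_n$ in $X$ and $y_1 < \cdots < y_n$ in $Y$ the determinant of $(K(x_i,y_j))_{i,j=1}^n$ is $\geq 0$ (respectively $> 0$). $F \circ K$ denotes the kernel $(x,y) \mapsto F(K(x,y))$.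
   Formalization: For totally positive kernels: the constant case is dropped (constants give zero 2x2 minors), F(x)=cx is claimed only for x>0 (F(0) is never seen), and some totally positive kernel of the given order on X×Y is assumed to exist (otherwise every F qualifies). *)

theory Defs
  imports Complex_Main "HOL-Library.FuncSet" "Jordan_Normal_Form.Determinant"
begin

text \<open>
  A kernel on X \<times> Y is represented by a function on the ambient types, of which only the
  values on X \<times> Y are ever used. The n x n kernel matrices are indexed from 0, and n may
  exceed the size of X or Y, in which case the condition for that n is vacuous.
\<close>

definition kernel_mat :: "nat \<Rightarrow> ('a \<Rightarrow> 'b \<Rightarrow> real) \<Rightarrow> (nat \<Rightarrow> 'a) \<Rightarrow> (nat \<Rightarrow> 'b) \<Rightarrow> real mat" where
  "kernel_mat n K x y = mat n n (\<lambda>(i, j). K (x i) (y j))"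

definition increasing_tuples :: "nat \<Rightarrow> 'a::linorder set \<Rightarrow> (nat \<Rightarrow> 'a) set" where
  "increasing_tuples n X = {x. x \<in> {..<n} \<rightarrow> X \<and> strict_mono_on {..<n} x}"

definition TN_kernels ::
    "nat \<Rightarrow> 'a::linorder set \<Rightarrow> 'b::linorder set \<Rightarrow> ('a \<Rightarrow> 'b \<Rightarrow> real) set" where
  "TN_kernels p X Y = {K. \<forall>n\<in>{1..p}. \<forall>x\<in>increasing_tuples n X. \<forall>y\<in>increasing_tuples n Y.
     det (kernel_mat n K x y) \<ge> 0}"

text \<open>
  For p \<ge> 2 this set is empty unless X and Y order-embed into the reals (when both have at least two
  elements: consider quotients of columns or rows); on an empty set every F would act vacuously. For p \<ge> 1 its kernels are
  everywhere > 0 on X \<times> Y, so the value F 0 cannot be detected by them.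
\<close>

definition TP_kernels ::
    "nat \<Rightarrow> 'a::linorder set \<Rightarrow> 'b::linorder set \<Rightarrow> ('a \<Rightarrow> 'b \<Rightarrow> real) set" where
  "TP_kernels p X Y = {K. \<forall>n\<in>{1..p}. \<forall>x\<in>increasing_tuples n X. \<forall>y\<in>increasing_tuples n Y.
     det (kernel_mat n K x y) > 0}"

text \<open>
  For p \<ge> 1 the kernels in \<^const>\<open>TN_kernels\<close> are non-negative on X \<times> Y, so the values of
  F at negative arguments, meaningless for F on [0, \<infinity>), play no role below.
\<close>

definition comp_op :: "(real \<Rightarrow> real) \<Rightarrow> ('a \<Rightarrow> 'b \<Rightarrow> real) \<Rightarrow> ('a \<Rightarrow> 'b \<Rightarrow> real)" where
  "comp_op F K = (\<lambda>x y. F (K x y))"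

end

(*
  A 2x2 matrix of determinant 0 stays totally non-negative when its columns are swapped, so a TN
  preserver satisfies F(xy) F(1) = F(x) F(y); being monotone, it is constant or F(x) = c x^a with
  F(0) = 0.  The tridiagonal matrix [1 1 0; 1 2 1; 0 1 1] forces 2^a >= 2.  If a > 1, all the powers
  x^(a^k) are preservers; applied to the totally non-negative matrix with entries 1 + l c_ij / a^k
  they converge to (e^l)^(c_ij), and for a suitable integer matrix c and e^l = 5/4 this limit has
  negative determinant.  Every 4x4 TN matrix extends by zero to a TN kernel on X x Y.

  In the TP case, a quotient of two columns (rows) of one TP kernel embeds X (Y) into the reals.
  Cauchy kernels then realise every 2x2 TP matrix, which makes F strictly increasing and continuous.
  Any 4x4 TN matrix A is a limit of TP kernels P M Q, where M is the direct sum of A and a large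
  identity matrix and P, Q are sech kernels that concentrate at the chosen nodes; positivity of all
  minors follows from the Cauchy-Binet formula.  So the continuous extension of F to 0 preserves
  4x4 TN matrices and the first part applies.
*)
theory Submission
  imports Defs
begin

section \<open>Determinants of kernel matrices\<close>

lemma permutes_less:
  fixes \<sigma> :: "nat \<Rightarrow> nat"
  assumes "\<sigma> permutes {0..<n}"
  shows "i < n \<Longrightarrow> \<sigma> i < n"
  using permutes_in_image[OF assms, of i] by simp

lemma kernel_mat_carrier [simp]: "kernel_mat n K x y \<in> carrier_mat n n"
  by (simp add: kernel_mat_def)

lemma kernel_mat_cong:
  assumes "\<And>i j. i < n \<Longrightarrow> j < n \<Longrightarrow> K (x i) (y j) = K' (x' i) (y' j)"
  shows "kernel_mat n K x y = kernel_mat n K' x' y'"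
  unfolding kernel_mat_def by (rule eq_matI) (use assms in auto)

lemma det_kernel_mat:
  "det (kernel_mat n K x y) =
    (\<Sum>\<sigma> | \<sigma> permutes {0..<n}. signof \<sigma> * (\<Prod>i=0..<n. K (x i) (y (\<sigma> i))))"
  unfolding det_def'[OF kernel_mat_carrier]
  by (intro sum.cong refl arg_cong2[of _ _ _ _ "(*)"] prod.cong)
     (auto simp: kernel_mat_def permutes_less)

lemma det_kernel_mat_0 [simp]: "det (kernel_mat 0 K x y) = 1"
  by (simp add: kernel_mat_def)

text \<open>Laplace expansion along row \<open>r\<close>. As \<open>insert_index r\<close> is the
  increasing map that skips \<open>r\<close>, the minors are again determinants of kernel
  matrices.\<close>

lemma det_kernel_mat_Suc:
  assumes "r < Suc n"
  shows "det (kernel_mat (Suc n) K x y) =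
    (\<Sum>j<Suc n. K (x r) (y j) * (-1) ^ (r + j) *
       det (kernel_mat n K (x \<circ> insert_index r) (y \<circ> insert_index j)))"
proof -
  have "mat_delete (kernel_mat (Suc n) K x y) r j
      = kernel_mat n K (x \<circ> insert_index r) (y \<circ> insert_index j)" for j
    unfolding mat_delete_def kernel_mat_def
    by (rule eq_matI) (auto simp: insert_index_def)
  then show ?thesis
    unfolding laplace_expansion_row[OF kernel_mat_carrier assms] cofactor_def
    by (intro sum.cong refl) (use assms in \<open>auto simp: kernel_mat_def mult.assoc\<close>)
qed

lemma det_kernel_mat_1: "det (kernel_mat 1 K x y) = K (x 0) (y 0)"
  by (simp add: det_kernel_mat_Suc[of 0])

lemma det_kernel_mat_2:
  "det (kernel_mat 2 K x y) = K (x 0) (y 0) * K (x 1) (y 1) - K (x 0) (y 1) * K (x 1) (y 0)"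
  by (simp add: numeral_2_eq_2 det_kernel_mat_Suc[of 0] insert_index_def)

lemma det_kernel_mat_3:
  "det (kernel_mat 3 K x y) =
    K (x 0) (y 0) * (K (x 1) (y 1) * K (x 2) (y 2) - K (x 1) (y 2) * K (x 2) (y 1)) -
    K (x 0) (y 1) * (K (x 1) (y 0) * K (x 2) (y 2) - K (x 1) (y 2) * K (x 2) (y 0)) +
    K (x 0) (y 2) * (K (x 1) (y 0) * K (x 2) (y 1) - K (x 1) (y 1) * K (x 2) (y 0))"
  by (simp add: eval_nat_numeral det_kernel_mat_Suc[of 0] insert_index_def algebra_simps)

lemma det_kernel_mat_4:
  "det (kernel_mat 4 K x y) =
    K (x 0) (y 0) * det (kernel_mat 3 K (x \<circ> Suc) (y \<circ> insert_index 0)) -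
    K (x 0) (y 1) * det (kernel_mat 3 K (x \<circ> Suc) (y \<circ> insert_index 1)) +
    K (x 0) (y 2) * det (kernel_mat 3 K (x \<circ> Suc) (y \<circ> insert_index 2)) -
    K (x 0) (y 3) * det (kernel_mat 3 K (x \<circ> Suc) (y \<circ> insert_index 3))"
proof -
  have [simp]: "insert_index 0 = Suc" by (auto simp: insert_index_def)
  have "4 = Suc 3" by simp
  then show ?thesis
    by (simp only: det_kernel_mat_Suc[OF zero_less_Suc]) (simp add: eval_nat_numeral)
qed

lemma det_kernel_mat_scale:
  "det (kernel_mat n (\<lambda>x y. f x * g y * K x y) x y)
    = (\<Prod>i<n. f (x i)) * (\<Prod>j<n. g (y j)) * det (kernel_mat n K x y)"
proof -
  have *: "(\<Prod>i=0..<n. f (x i) * g (y (\<sigma> i)) * K (x i) (y (\<sigma> i)))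
      = (\<Prod>i<n. f (x i)) * (\<Prod>j<n. g (y j)) * (\<Prod>i=0..<n. K (x i) (y (\<sigma> i)))"
    if "\<sigma> permutes {0..<n}" for \<sigma>
    using prod.permute[OF that, of "\<lambda>j. g (y j)"]
    by (simp add: prod.distrib lessThan_atLeast0 o_def)
  show ?thesis
    unfolding det_kernel_mat sum_distrib_left
    by (intro sum.cong refl) (use * in \<open>simp add: mult_ac\<close>)
qed

text \<open>A determinant is a polynomial in the entries. The limit has tuples of its own, so that
  kernels on \<open>X\<close> and \<open>Y\<close> may converge to a matrix indexed by
  numbers.\<close>

lemma tendsto_det_kernel_mat:
  fixes K :: "'c \<Rightarrow> 'a \<Rightarrow> 'b \<Rightarrow> real"
  assumes "\<And>i j. i < n \<Longrightarrow> j < n \<Longrightarrow> ((\<lambda>t. K t (x i) (y j)) \<longlongrightarrow> L (x' i) (y' j)) F"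
  shows "((\<lambda>t. det (kernel_mat n (K t) x y)) \<longlongrightarrow> det (kernel_mat n L x' y')) F"
  unfolding det_kernel_mat
  by (intro tendsto_intros assms) (auto simp: permutes_less)

lemma det_kernel_mat_zero_row:
  assumes "r < n" "\<And>j. j < n \<Longrightarrow> K (x r) (y j) = 0"
  shows "det (kernel_mat n K x y) = 0"
proof -
  have "(\<Prod>i=0..<n. K (x i) (y (\<sigma> i))) = 0" if "\<sigma> permutes {0..<n}" for \<sigma>
    using assms permutes_less[OF that] by (intro prod_zero bexI[of _ r]) auto
  then show ?thesis unfolding det_kernel_mat by (intro sum.neutral) simp
qed

lemma det_kernel_mat_transpose:
  "det (kernel_mat n K x y) = det (kernel_mat n (\<lambda>y x. K x y) y x)"
proof -
  have "kernel_mat n (\<lambda>y x. K x y) y x = transpose_mat (kernel_mat n K x y)"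
    unfolding kernel_mat_def by (rule eq_matI) auto
  then show ?thesis by (simp add: det_transpose[of _ n])
qed

lemma det_kernel_mat_zero_column:
  assumes "c < n" "\<And>i. i < n \<Longrightarrow> K (x i) (y c) = 0"
  shows "det (kernel_mat n K x y) = 0"
  unfolding det_kernel_mat_transpose[of n K] using assms by (intro det_kernel_mat_zero_row) auto

lemma det_kernel_mat_permute_rows:
  assumes "\<sigma> permutes {0..<n}"
  shows "det (kernel_mat n K (x \<circ> \<sigma>) y) = signof \<sigma> * det (kernel_mat n K x y)"
proof -
  have "kernel_mat n K (x \<circ> \<sigma>) y = mat n n (\<lambda>(i,j). kernel_mat n K x y $$ (\<sigma> i, j))"
    unfolding kernel_mat_def using permutes_less[OF assms] by (intro eq_matI) auto
  then show ?thesis by (simp add: det_permute_rows[OF _ assms])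
qed

lemma det_kernel_mat_permute_columns:
  assumes "\<sigma> permutes {0..<n}"
  shows "det (kernel_mat n K x (y \<circ> \<sigma>)) = signof \<sigma> * det (kernel_mat n K x y)"
  unfolding det_kernel_mat_transpose[of n K] by (rule det_kernel_mat_permute_rows[OF assms])

lemma det_kernel_mat_not_inj:
  assumes "\<not> inj_on x {..<n}"
  shows "det (kernel_mat n K x y) = 0"
proof -
  obtain i j where ij: "i < n" "j < n" "i \<noteq> j" "x i = x j"
    using assms by (auto simp: inj_on_def)
  show ?thesis
    by (rule det_identical_rows[of _ n i j]) (use ij in \<open>auto simp: kernel_mat_def intro!: eq_vecI\<close>)
qed

section \<open>Gaussian elimination and the Cauchy-Binet formula\<close>

text \<open>One step of Gaussian elimination, as a factorisation into a unit lower triangular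
  \<open>L\<close> and a matrix \<open>U\<close> whose first column vanishes below the
  pivot.\<close>

lemma det_kernel_mat_schur:
  assumes "K (x 0) (y 0) \<noteq> 0"
  shows "det (kernel_mat (Suc n) K x y) = K (x 0) (y 0) *
    det (kernel_mat n (\<lambda>a b. K a b - K a (y 0) * K (x 0) b / K (x 0) (y 0)) (x \<circ> Suc) (y \<circ> Suc))"
proof -
  let ?K = "\<lambda>i j. K (x i) (y j)"
  define L where "L = mat (Suc n) (Suc n) (\<lambda>(i,j). if i = j then 1 else if j = 0 then ?K i 0 / ?K 0 0 else 0)"
  define U' where "U' i j = (if i = 0 then ?K 0 j else ?K i j - ?K i 0 * ?K 0 j / ?K 0 0)" for i j
  define U where "U = kernel_mat (Suc n) U' (\<lambda>i. i) (\<lambda>j. j)"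
  have L: "L \<in> carrier_mat (Suc n) (Suc n)" by (simp add: L_def)
  have U: "U \<in> carrier_mat (Suc n) (Suc n)" by (simp add: U_def)
  have "kernel_mat (Suc n) K x y = L * U"
  proof (rule eq_matI)
    fix i j assume "i < dim_row (L * U)" "j < dim_col (L * U)"
    then have ij: "i < Suc n" "j < Suc n" using L U by auto
    then have "(L * U) $$ (i,j) = (\<Sum>k<Suc n. L $$ (i,k) * U $$ (k,j))"
      using L U by (simp add: scalar_prod_def lessThan_atLeast0)
    \<comment> \<open>Row \<open>i\<close> of \<open>L\<close> is nonzero at most in columns
      \<open>0\<close> and \<open>i\<close>; the shift of the summation index turns the latter into
      \<open>i - 1\<close>.\<close>
    also have "\<dots> = L $$ (i,0) * U $$ (0,j) + (\<Sum>k<n. if k = i - 1 \<and> i \<noteq> 0 then U $$ (i,j) else 0)"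
      unfolding sum.lessThan_Suc_shift
      by (intro arg_cong2[of _ _ _ _ "(+)"] refl sum.cong) (use ij in \<open>auto simp: L_def\<close>)
    also have "\<dots> = ?K i j"
      using assms ij by (cases i) (auto simp: L_def U_def U'_def kernel_mat_def)
    finally show "kernel_mat (Suc n) K x y $$ (i,j) = (L * U) $$ (i,j)"
      using ij by (simp add: kernel_mat_def)
  qed (use L U in \<open>auto simp: kernel_mat_def\<close>)
  then have "det (kernel_mat (Suc n) K x y) = det L * det U"
    using det_mult[OF L U] by simp
  also have "det L = 1"
  proof -
    have "diag_mat L = replicate (Suc n) 1"
      unfolding diag_mat_def by (rule nth_equalityI) (auto simp: L_def simp del: upt_Suc replicate_Suc)
    then have "prod_list (diag_mat L) = 1" by (simp only: prod_list_replicate power_one)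
    then show ?thesis by (subst det_lower_triangular[OF _ L]) (auto simp: L_def)
  qed
  \<comment> \<open>\<open>U' i 0 = 0\<close> for \<open>i > 0\<close>, so the expansion along the
    first column, which is the first row of the transpose, has a single term.\<close>
  also have "det U = U' 0 0 * det (kernel_mat n (\<lambda>b a. U' a b) Suc Suc)"
    unfolding U_def det_kernel_mat_transpose[of _ U'] det_kernel_mat_Suc[OF zero_less_Suc]
      sum.lessThan_Suc_shift
    using assms by (simp add: U'_def o_def)
  also have "det (kernel_mat n (\<lambda>b a. U' a b) Suc Suc) =
      det (kernel_mat n (\<lambda>a b. K a b - K a (y 0) * K (x 0) b / K (x 0) (y 0)) (x \<circ> Suc) (y \<circ> Suc))"
    unfolding det_kernel_mat_transpose[of _ "\<lambda>b a. U' a b"]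
    by (intro arg_cong[of _ _ det] kernel_mat_cong) (simp add: U'_def)
  finally show ?thesis by (simp add: U'_def)
qed

text \<open>
  The Cauchy-Binet formula, summed over all maps f instead of the increasing ones: maps that are not
  injective contribute 0 and each increasing tuple is counted n! times.
\<close>

lemma cauchy_binet_kernel_mat:
  fixes P :: "'a \<Rightarrow> nat \<Rightarrow> real" and Q :: "nat \<Rightarrow> 'b \<Rightarrow> real"
  shows "fact n * det (kernel_mat n (\<lambda>x y. \<Sum>k<N. P x k * Q k y) x y)
    = (\<Sum>f\<in>{0..<n} \<rightarrow>\<^sub>E {..<N}. det (kernel_mat n P x f) * det (kernel_mat n Q f y))"
proof -
  let ?inv = Hilbert_Choice.inv and ?F = "{0..<n} \<rightarrow>\<^sub>E {..<N}" and ?U = "{0..<n}"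
  \<comment> \<open>A product over the rows of sums over \<open>k\<close> is a sum over the
    functions \<open>f\<close> that choose one \<open>k\<close> for each row.\<close>
  have step: "det (kernel_mat n (\<lambda>x y. \<Sum>k<N. P x k * Q k y) x y)
      = (\<Sum>f\<in>?F. (\<Prod>i\<in>?U. P (x i) (f i)) * det (kernel_mat n Q f y))"
  proof -
    have "det (kernel_mat n (\<lambda>x y. \<Sum>k<N. P x k * Q k y) x y)
      = (\<Sum>\<sigma> | \<sigma> permutes ?U. signof \<sigma> * (\<Sum>f\<in>?F. \<Prod>i\<in>?U. P (x i) (f i) * Q (f i) (y (\<sigma> i))))"
      unfolding det_kernel_mat by (simp add: prod_sum_PiE)
    also have "\<dots> = (\<Sum>f\<in>?F. \<Sum>\<sigma> | \<sigma> permutes ?U. signof \<sigma> * (\<Prod>i\<in>?U. P (x i) (f i) * Q (f i) (y (\<sigma> i))))"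
      unfolding sum_distrib_left by (rule sum.swap)
    also have "\<dots> = (\<Sum>f\<in>?F. (\<Prod>i\<in>?U. P (x i) (f i)) * det (kernel_mat n Q f y))"
      unfolding det_kernel_mat sum_distrib_left by (intro sum.cong refl) (simp add: prod.distrib mult_ac)
    finally show ?thesis .
  qed
  \<comment> \<open>Passing from \<open>f\<close> to \<open>f \<circ> \<sigma>\<close> permutes the
    range of summation and extracts the sign from the \<open>Q\<close> determinant. Summation over
    \<open>\<sigma>\<close> completes the \<open>P\<close> determinant on one side and gives
    \<open>fact n\<close> equal terms on the other.\<close>
  have reindex: "(\<Sum>f\<in>?F. signof \<sigma> * (\<Prod>i\<in>?U. P (x i) (f (\<sigma> i))) * det (kernel_mat n Q f y))
      = (\<Sum>f\<in>?F. (\<Prod>i\<in>?U. P (x i) (f i)) * det (kernel_mat n Q f y))"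
    if s: "\<sigma> permutes ?U" for \<sigma>
  proof (rule sum.reindex_bij_witness[of _ "\<lambda>f. f \<circ> ?inv \<sigma>" "\<lambda>f. f \<circ> \<sigma>"])
    note inv = permutes_inverses[OF s] permutes_inv[OF s]
    fix f assume f: "f \<in> ?F"
    have out: "\<sigma> i = i" "?inv \<sigma> i = i" if "i \<notin> ?U" for i
      using that s inv(3) by (auto simp: permutes_def)
    have inU: "\<sigma> i \<in> ?U" "?inv \<sigma> i \<in> ?U" if "i \<in> ?U" for i
      using that permutes_in_image[OF s] permutes_in_image[OF inv(3)] by auto
    show "f \<circ> \<sigma> \<circ> ?inv \<sigma> = f" "f \<circ> ?inv \<sigma> \<circ> \<sigma> = f" using inv by (auto simp: fun_eq_iff)
    show "f \<circ> \<sigma> \<in> ?F" "f \<circ> ?inv \<sigma> \<in> ?F"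
      using f inU out unfolding PiE_iff extensional_def by (auto simp del: atLeastLessThan_iff)
    have "signof \<sigma> * (\<Prod>i\<in>?U. P (x i) (f (\<sigma> i))) * det (kernel_mat n Q f y)
       = (\<Prod>i\<in>?U. P (x i) ((f \<circ> \<sigma>) i)) * (signof \<sigma> * det (kernel_mat n Q f y))"
      by simp
    then show "(\<Prod>i\<in>?U. P (x i) ((f \<circ> \<sigma>) i)) * det (kernel_mat n Q (f \<circ> \<sigma>) y)
       = signof \<sigma> * (\<Prod>i\<in>?U. P (x i) (f (\<sigma> i))) * det (kernel_mat n Q f y)"
      unfolding det_kernel_mat_permute_rows[OF s] by simp
  qed
  have "(\<Sum>f\<in>?F. det (kernel_mat n P x f) * det (kernel_mat n Q f y))
      = (\<Sum>\<sigma> | \<sigma> permutes ?U. \<Sum>f\<in>?F. signof \<sigma> * (\<Prod>i\<in>?U. P (x i) (f (\<sigma> i))) * det (kernel_mat n Q f y))"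
    unfolding det_kernel_mat[of n P] sum_distrib_right by (rule sum.swap)
  also have "\<dots> = (\<Sum>\<sigma> | \<sigma> permutes ?U. det (kernel_mat n (\<lambda>x y. \<Sum>k<N. P x k * Q k y) x y))"
    unfolding step by (intro sum.cong refl reindex) auto
  also have "\<dots> = fact n * det (kernel_mat n (\<lambda>x y. \<Sum>k<N. P x k * Q k y) x y)"
    by (simp add: card_permutations[of _ n])
  finally show ?thesis by simp
qed

section \<open>Totally non-negative and totally positive kernels\<close>

lemma increasing_tuplesI:
  assumes "\<And>i. i < n \<Longrightarrow> x i \<in> X" "\<And>i j. i < j \<Longrightarrow> j < n \<Longrightarrow> x i < x j"
  shows "x \<in> increasing_tuples n X"
  using assms by (simp add: increasing_tuples_def strict_mono_on_def)

lemma increasing_tuplesD: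
  assumes "x \<in> increasing_tuples n X"
  shows "i < n \<Longrightarrow> x i \<in> X" "i < j \<Longrightarrow> j < n \<Longrightarrow> x i < x j"
  using assms by (simp_all add: increasing_tuples_def strict_mono_on_def Pi_iff)

lemma increasing_tuples_Suc:
  assumes "x \<in> increasing_tuples (Suc n) X"
  shows "x \<circ> insert_index r \<in> increasing_tuples n X"
  by (rule increasing_tuplesI) (simp_all add: insert_index_def increasing_tuplesD[OF assms])

lemma increasing_tuples_comp_index:
  assumes u: "u \<in> increasing_tuples m X" and x: "x \<in> increasing_tuples n {..<m}"
  shows "u \<circ> x \<in> increasing_tuples n X"
proof (rule increasing_tuplesI)
  have lt: "x i < m" if "i < n" for i using increasing_tuplesD(1)[OF x that] by simp
  show "(u \<circ> x) i \<in> X" if "i < n" for i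
    using increasing_tuplesD(1)[OF u lt[OF that]] by simp
  show "(u \<circ> x) i < (u \<circ> x) j" if "i < j" "j < n" for i j
    using increasing_tuplesD(2)[OF u increasing_tuplesD(2)[OF x that] lt[OF that(2)]] by simp
qed

lemma increasing_tuples_id: "n \<le> m \<Longrightarrow> (\<lambda>i. i) \<in> increasing_tuples n {..<m}"
  by (rule increasing_tuplesI) auto

lemma increasing_tuples_exists:
  assumes "infinite X \<or> m \<le> card X"
  obtains u where "u \<in> increasing_tuples m X"
proof -
  obtain S where S: "S \<subseteq> X" "finite S" "card S = m"
    using assms infinite_arbitrarily_large[of X m] obtain_subset_with_card_n[of m X]
    by (metis card_eq_0_iff finite_subset)
  define xs where "xs = sorted_list_of_set S"
  have "length xs = m" "set xs = S" "sorted_wrt (<) xs"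
    using S by (auto simp: xs_def)
  then have "(\<lambda>i. xs ! i) \<in> increasing_tuples m X"
    using S(1) by (intro increasing_tuplesI) (auto simp: sorted_wrt_iff_nth_less)
  then show ?thesis by (rule that)
qed

lemma TN_kernelsD:
  assumes "K \<in> TN_kernels p X Y" "1 \<le> n" "n \<le> p" "x \<in> increasing_tuples n X" "y \<in> increasing_tuples n Y"
  shows "det (kernel_mat n K x y) \<ge> 0"
  using assms by (auto simp: TN_kernels_def)

lemma TP_kernelsD:
  assumes "K \<in> TP_kernels p X Y" "1 \<le> n" "n \<le> p" "x \<in> increasing_tuples n X" "y \<in> increasing_tuples n Y"
  shows "det (kernel_mat n K x y) > 0"
  using assms by (auto simp: TP_kernels_def)

lemma TP_imp_TN_kernels: "K \<in> TP_kernels p X Y \<Longrightarrow> K \<in> TN_kernels p X Y"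
  by (auto simp: TP_kernels_def TN_kernels_def intro: less_imp_le)

lemma TN_kernels_nonneg:
  assumes "K \<in> TN_kernels p X Y" "1 \<le> p" "x \<in> X" "y \<in> Y"
  shows "K x y \<ge> 0"
  using TN_kernelsD[OF assms(1), of 1 "\<lambda>_. x" "\<lambda>_. y"] assms
  by (auto intro!: increasing_tuplesI simp: det_kernel_mat_1[simplified])

lemma TP_kernels_pos:
  assumes "K \<in> TP_kernels p X Y" "1 \<le> p" "x \<in> X" "y \<in> Y"
  shows "K x y > 0"
  using TP_kernelsD[OF assms(1), of 1 "\<lambda>_. x" "\<lambda>_. y"] assms
  by (auto intro!: increasing_tuplesI simp: det_kernel_mat_1[simplified])

lemma TN_kernels_cong:
  assumes "\<And>x y. x \<in> X \<Longrightarrow> y \<in> Y \<Longrightarrow> K x y = L x y"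
  shows "K \<in> TN_kernels p X Y \<longleftrightarrow> L \<in> TN_kernels p X Y"
proof -
  have "kernel_mat n K x y = kernel_mat n L x y"
    if "x \<in> increasing_tuples n X" "y \<in> increasing_tuples n Y" for n x y
    using increasing_tuplesD(1)[OF that(1)] increasing_tuplesD(1)[OF that(2)]
    by (intro kernel_mat_cong assms)
  then show ?thesis by (simp add: TN_kernels_def)
qed

lemma TP_kernels_cong:
  assumes "\<And>x y. x \<in> X \<Longrightarrow> y \<in> Y \<Longrightarrow> K x y = L x y"
  shows "K \<in> TP_kernels p X Y \<longleftrightarrow> L \<in> TP_kernels p X Y"
proof -
  have "kernel_mat n K x y = kernel_mat n L x y"
    if "x \<in> increasing_tuples n X" "y \<in> increasing_tuples n Y" for n x y
    using increasing_tuplesD(1)[OF that(1)] increasing_tuplesD(1)[OF that(2)]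
    by (intro kernel_mat_cong assms)
  then show ?thesis by (simp add: TP_kernels_def)
qed

lemma TN_kernels_const:
  assumes "c \<ge> 0"
  shows "(\<lambda>x y. c) \<in> TN_kernels p X Y"
  unfolding TN_kernels_def mem_Collect_eq
proof (intro ballI)
  fix n x y assume n: "n \<in> {1..p}"
  show "det (kernel_mat n (\<lambda>x y. c) x y) \<ge> 0"
  proof (cases "n = 1")
    case True
    then show ?thesis using assms by (simp add: det_kernel_mat_1[simplified])
  next
    case False
    \<comment> \<open>The kernel ignores its arguments, so the row tuple may be replaced by a
      constant one, which makes all rows equal.\<close>
    have "\<not> inj_on (\<lambda>_. 0::nat) {..<n}"
    proof
      assume "inj_on (\<lambda>_. 0::nat) {..<n}"
      then have "(0::nat) = 1" by (rule inj_onD) (use n False in auto)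
      then show False by simp
    qed
    then have "det (kernel_mat n (\<lambda>x y. c) (\<lambda>_. 0::nat) y) = 0"
      by (rule det_kernel_mat_not_inj)
    then show ?thesis by (simp add: kernel_mat_def)
  qed
qed

lemma TN_kernels_cmult:
  assumes "K \<in> TN_kernels p X Y" "c \<ge> 0"
  shows "(\<lambda>x y. c * K x y) \<in> TN_kernels p X Y"
proof -
  have "det (kernel_mat n (\<lambda>x y. c * K x y) x y) = c ^ n * det (kernel_mat n K x y)" for n x y
    using det_kernel_mat_scale[of n "\<lambda>_. c" "\<lambda>_. 1" K x y] by simp
  then show ?thesis using assms by (simp add: TN_kernels_def)
qed

lemma TP_kernels_scale:
  assumes "K \<in> TP_kernels p X Y" "\<And>x. x \<in> X \<Longrightarrow> f x > 0" "\<And>y. y \<in> Y \<Longrightarrow> g y > 0"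
  shows "(\<lambda>x y. f x * g y * K x y) \<in> TP_kernels p X Y"
  unfolding TP_kernels_def
proof safe
  fix n x y assume *: "n \<in> {1..p}" "x \<in> increasing_tuples n X" "y \<in> increasing_tuples n Y"
  then have "(\<Prod>i<n. f (x i)) > 0" "(\<Prod>i<n. g (y i)) > 0"
    using assms(2,3) unfolding increasing_tuples_def by (blast intro!: prod_pos)+
  then show "det (kernel_mat n (\<lambda>x y. f x * g y * K x y) x y) > 0"
    unfolding det_kernel_mat_scale using TP_kernelsD[OF assms(1), of n x y] * by simp
qed

lemma TP_kernels_transpose:
  assumes "K \<in> TP_kernels p X Y"
  shows "(\<lambda>y x. K x y) \<in> TP_kernels p Y X"
  unfolding TP_kernels_def mem_Collect_eq
  by (intro ballI, subst det_kernel_mat_transpose, rule TP_kernelsD[OF assms]) auto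

section \<open>Compositions of kernels\<close>

text \<open>Brings the maps of the Cauchy-Binet sum into increasing order: \<open>\<sigma> i\<close>
  is the place where \<open>f\<close> takes its \<open>i\<close>-th smallest value, counted from
  0.\<close>

lemma inj_on_imp_sorting_permutation:
  fixes f :: "nat \<Rightarrow> 'a::linorder"
  assumes "inj_on f {..<n}"
  obtains \<sigma> where "\<sigma> permutes {0..<n}" "strict_mono_on {..<n} (f \<circ> \<sigma>)"
proof -
  define xs where "xs = sorted_list_of_set (f ` {..<n})"
  define \<sigma> where "\<sigma> i = (if i < n then inv_into {..<n} f (xs ! i) else i)" for i
  have len: "length xs = n" and set: "set xs = f ` {..<n}" and "distinct xs"
    using card_image[OF assms] by (auto simp: xs_def)
  have nth: "xs ! i \<in> f ` {..<n}" if "i < n" for i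
    using that len set nth_mem by blast
  have f: "f (\<sigma> i) = xs ! i" if "i < n" for i
    using f_inv_into_f[OF nth[OF that]] that by (simp add: \<sigma>_def)
  have "bij_betw \<sigma> {0..<n} {0..<n}"
    unfolding bij_betw_def
  proof (intro conjI endo_inj_surj)
    show "inj_on \<sigma> {0..<n}"
    proof (rule inj_onI)
      fix i j assume "i \<in> {0..<n}" "j \<in> {0..<n}" "\<sigma> i = \<sigma> j"
      then show "i = j"
        using f[of i] f[of j] nth_eq_iff_index_eq[OF \<open>distinct xs\<close>, of i j] len by simp
    qed
    then show "inj_on \<sigma> {0..<n}" .
    show "\<sigma> ` {0..<n} \<subseteq> {0..<n}"
      using inv_into_into[OF nth] by (auto simp: \<sigma>_def)
  qed simp
  then have "\<sigma> permutes {0..<n}" by (rule bij_imp_permutes) (simp add: \<sigma>_def)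
  moreover have "strict_mono_on {..<n} (f \<circ> \<sigma>)"
  proof (rule strict_mono_onI)
    fix i j assume "i \<in> {..<n}" "j \<in> {..<n}" "i < j"
    moreover have "sorted_wrt (<) xs" unfolding xs_def by (rule strict_sorted_list_of_set)
    ultimately show "(f \<circ> \<sigma>) i < (f \<circ> \<sigma>) j" using f len by (simp add: sorted_wrt_iff_nth_less)
  qed
  ultimately show ?thesis by (rule that)
qed

text \<open>Sorting \<open>f\<close> multiplies both determinants by the same sign, which cancels in
  the product.\<close>

lemma det_mult_det_nonneg:
  fixes P :: "'a \<Rightarrow> nat \<Rightarrow> real" and Q :: "nat \<Rightarrow> 'b \<Rightarrow> real"
  assumes "f \<in> {0..<n} \<rightarrow>\<^sub>E {..<N}"
    and "\<And>z. z \<in> increasing_tuples n {..<N} \<Longrightarrow> det (kernel_mat n P x z) \<ge> 0"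
    and "\<And>z. z \<in> increasing_tuples n {..<N} \<Longrightarrow> det (kernel_mat n Q z y) \<ge> 0"
  shows "det (kernel_mat n P x f) * det (kernel_mat n Q f y) \<ge> 0"
proof (cases "inj_on f {..<n}")
  case True
  then obtain \<sigma> where s: "\<sigma> permutes {0..<n}" "strict_mono_on {..<n} (f \<circ> \<sigma>)"
    by (rule inj_on_imp_sorting_permutation)
  have "f \<circ> \<sigma> \<in> increasing_tuples n {..<N}"
    using s assms(1) permutes_less[OF s(1)] by (auto simp: increasing_tuples_def PiE_iff)
  from mult_nonneg_nonneg[OF assms(2,3)[OF this]]
  have "(signof \<sigma> * signof \<sigma>) * (det (kernel_mat n P x f) * det (kernel_mat n Q f y)) \<ge> 0"
    unfolding det_kernel_mat_permute_columns[OF s(1)] det_kernel_mat_permute_rows[OF s(1)]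
    by (simp add: mult_ac)
  then show ?thesis by (simp add: sign_def split: if_splits)
qed (simp add: det_kernel_mat_not_inj)

lemma det_kernel_compose_nonneg:
  fixes P :: "'a \<Rightarrow> nat \<Rightarrow> real" and Q :: "nat \<Rightarrow> 'b \<Rightarrow> real"
  assumes "\<And>z. z \<in> increasing_tuples n {..<N} \<Longrightarrow> det (kernel_mat n P x z) \<ge> 0"
    and "\<And>z. z \<in> increasing_tuples n {..<N} \<Longrightarrow> det (kernel_mat n Q z y) \<ge> 0"
  shows "det (kernel_mat n (\<lambda>x y. \<Sum>k<N. P x k * Q k y) x y) \<ge> 0"
proof -
  have "fact n * det (kernel_mat n (\<lambda>x y. \<Sum>k<N. P x k * Q k y) x y) \<ge> 0"
    unfolding cauchy_binet_kernel_mat by (intro sum_nonneg det_mult_det_nonneg assms)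
  then show ?thesis using fact_gt_zero[of n, where 'a = real] by (auto simp: zero_le_mult_iff)
qed

text \<open>All terms of the Cauchy-Binet sum are non-negative, so one strictly positive term
  suffices.\<close>

lemma det_kernel_compose_pos:
  fixes P :: "'a \<Rightarrow> nat \<Rightarrow> real" and Q :: "nat \<Rightarrow> 'b \<Rightarrow> real"
  assumes "\<And>z. z \<in> increasing_tuples n {..<N} \<Longrightarrow> det (kernel_mat n P x z) \<ge> 0"
    and "\<And>z. z \<in> increasing_tuples n {..<N} \<Longrightarrow> det (kernel_mat n Q z y) \<ge> 0"
    and w: "w \<in> increasing_tuples n {..<N}" "det (kernel_mat n P x w) > 0" "det (kernel_mat n Q w y) > 0"
  shows "det (kernel_mat n (\<lambda>x y. \<Sum>k<N. P x k * Q k y) x y) > 0"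
proof -
  \<comment> \<open>The sum runs over extensional functions, hence the restriction.\<close>
  define f where "f = restrict w {0..<n}"
  have f: "f \<in> {0..<n} \<rightarrow>\<^sub>E {..<N}" using w(1) by (auto simp: f_def increasing_tuples_def)
  have eq: "kernel_mat n P x f = kernel_mat n P x w" "kernel_mat n Q f y = kernel_mat n Q w y"
    by (auto intro!: kernel_mat_cong simp: f_def)
  have "0 < det (kernel_mat n P x f) * det (kernel_mat n Q f y)"
    unfolding eq using w by simp
  also have "\<dots> \<le> (\<Sum>f\<in>{0..<n} \<rightarrow>\<^sub>E {..<N}. det (kernel_mat n P x f) * det (kernel_mat n Q f y))"
    using f by (intro member_le_sum det_mult_det_nonneg assms finite_PiE) auto
  finally have "fact n * det (kernel_mat n (\<lambda>x y. \<Sum>k<N. P x k * Q k y) x y) > 0"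
    unfolding cauchy_binet_kernel_mat .
  then show ?thesis using fact_gt_zero[of n, where 'a = real] by (auto simp: zero_less_mult_iff)
qed

lemma TN_kernels_compose:
  fixes P :: "'a::linorder \<Rightarrow> nat \<Rightarrow> real" and Q :: "nat \<Rightarrow> 'b::linorder \<Rightarrow> real"
  assumes "P \<in> TN_kernels p X {..<N}" "Q \<in> TN_kernels p {..<N} Y"
  shows "(\<lambda>x y. \<Sum>k<N. P x k * Q k y) \<in> TN_kernels p X Y"
  unfolding TN_kernels_def
  by (auto intro!: det_kernel_compose_nonneg TN_kernelsD[OF assms(1)] TN_kernelsD[OF assms(2)])

section \<open>Direct sums and extensions by zero\<close>

text \<open>Induction on the order of the minor: outside the block, the last row or column either
  vanishes or can be split off with corner entry 1.\<close>

lemma TN_kernels_direct_sum_identity: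
  fixes A :: "nat \<Rightarrow> nat \<Rightarrow> real"
  assumes "A \<in> TN_kernels p {..<m} {..<m}"
  shows "(\<lambda>i j. if i < m \<and> j < m then A i j else of_bool (i = j)) \<in> TN_kernels p Z W"
proof -
  let ?M = "\<lambda>i j. if i < m \<and> j < m then A i j else of_bool (i = j)"
  have "det (kernel_mat n ?M x y) \<ge> 0"
    if "n \<le> p" "x \<in> increasing_tuples n UNIV" "y \<in> increasing_tuples n UNIV" for n x y
    using that
  proof (induction n arbitrary: x y)
    case (Suc n)
    note x = increasing_tuplesD(2)[OF Suc.prems(2)] and y = increasing_tuplesD(2)[OF Suc.prems(3)]
    have x_le: "x i \<le> x n" and y_le: "y i \<le> y n" if "i < Suc n" for i
      using x[of i n] y[of i n] that by (cases "i = n"; simp)+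
    \<comment> \<open>In this order: the whole minor lies in the block; the last column index
      exceeds all row indices, so that column is zero; the corner entry 1 is alone in its row; the
      last row is zero; the last column is zero.\<close>
    consider "x n < m" "y n < m" | j where "x n \<ge> m" "j < n" "y j = x n" | "x n \<ge> m" "y n = x n"
      | "x n \<ge> m" "\<forall>j<Suc n. y j \<noteq> x n" | "x n < m" "y n \<ge> m"
      using less_Suc_eq not_less by metis
    then show ?case
    proof cases
      case 1
      then have lt: "x i < m" "y i < m" if "i < Suc n" for i
        using x_le[OF that] y_le[OF that] by auto
      have "kernel_mat (Suc n) ?M x y = kernel_mat (Suc n) A x y"
        by (rule kernel_mat_cong) (use lt in auto)
      moreover have "x \<in> increasing_tuples (Suc n) {..<m}" "y \<in> increasing_tuples (Suc n) {..<m}"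
        using lt x y by (auto intro!: increasing_tuplesI)
      ultimately show ?thesis using TN_kernelsD[OF assms, of "Suc n" x y] Suc.prems(1) by simp
    next
      case 2
      then have "y n > x n" using y[of j n] by simp
      then have "\<not> y n < m" "x i \<noteq> y n" if "i < Suc n" for i using x_le[OF that] 2(1) by auto
      then have "det (kernel_mat (Suc n) ?M x y) = 0"
        by (intro det_kernel_mat_zero_column[of n]) auto
      then show ?thesis by simp
    next
      case 3
      have "?M (x n) (y j) = of_bool (j = n)" if "j < Suc n" for j
        using 3 y[of j n] that by (cases "j = n") auto
      then have "det (kernel_mat (Suc n) ?M x y)
          = (\<Sum>j<Suc n. of_bool (j = n) * (-1) ^ (n + j) *
              det (kernel_mat n ?M (x \<circ> insert_index n) (y \<circ> insert_index j)))"
        unfolding det_kernel_mat_Suc[OF lessI] by (intro sum.cong refl) (simp only: lessThan_iff)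
      also have "\<dots> = det (kernel_mat n ?M (x \<circ> insert_index n) (y \<circ> insert_index n))"
        by simp
      also have "\<dots> \<ge> 0"
        using Suc.prems by (intro Suc.IH increasing_tuples_Suc) auto
      finally show ?thesis .
    next
      case 4
      then have "det (kernel_mat (Suc n) ?M x y) = 0"
        by (intro det_kernel_mat_zero_row[of n]) auto
      then show ?thesis by simp
    next
      case 5
      then have "x i \<noteq> y n" if "i < Suc n" for i using x_le[OF that] by auto
      with 5 have "det (kernel_mat (Suc n) ?M x y) = 0"
        by (intro det_kernel_mat_zero_column[of n]) auto
      then show ?thesis by simp
    qed
  qed simp
  moreover have "increasing_tuples n V \<subseteq> increasing_tuples n UNIV" for n and V :: "nat set"
    by (auto simp: increasing_tuples_def)
  ultimately show ?thesis unfolding TN_kernels_def by (simp add: subset_iff)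
qed

text \<open>A minor that leaves the nodes has a zero row or column; every other minor is a minor of
  \<open>A\<close>.\<close>

lemma TN_kernels_extend_by_zero:
  assumes A: "A \<in> TN_kernels p {..<m} {..<m}"
    and u: "u \<in> increasing_tuples m X" and v: "v \<in> increasing_tuples m Y"
  obtains K where "K \<in> TN_kernels p X Y" "\<And>i j. i < m \<Longrightarrow> j < m \<Longrightarrow> K (u i) (v j) = A i j"
proof -
  define K where "K x y = (if x \<in> u ` {..<m} \<and> y \<in> v ` {..<m}
      then A (inv_into {..<m} u x) (inv_into {..<m} v y) else 0)" for x y
  have su: "strict_mono_on {..<m} u" and sv: "strict_mono_on {..<m} v"
    using u v by (auto simp: increasing_tuples_def)
  note inj = strict_mono_on_imp_inj_on[OF su] strict_mono_on_imp_inj_on[OF sv]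
  have K: "K (u i) (v j) = A i j" if "i < m" "j < m" for i j
    using that inj by (simp add: K_def)
  \<comment> \<open>A strictly increasing \<open>w\<close> reflects the order, so a tuple running
    through the nodes comes from increasing indices.\<close>
  have pull: "\<exists>z \<in> increasing_tuples n {..<m}. \<forall>i<n. x i = w (z i)"
    if x: "x \<in> increasing_tuples n Z" and w: "strict_mono_on {..<m} w" and sub: "\<forall>i<n. x i \<in> w ` {..<m}"
    for n Z and x w :: "nat \<Rightarrow> 'c::linorder"
  proof -
    obtain z where z: "\<And>i. i < n \<Longrightarrow> z i < m \<and> x i = w (z i)"
      using sub by (auto simp: image_iff Bex_def) metis
    have "z i < z j" if "i < j" "j < n" for i j
    proof (rule ccontr)
      assume "\<not> z i < z j"
      then have "w (z j) \<le> w (z i)"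
        using z that strict_mono_on_leD[OF w, of "z j" "z i"] by simp
      then show False using increasing_tuplesD(2)[OF x that] z that by (auto dest: less_trans)
    qed
    then show ?thesis using z by (intro bexI[of _ z] increasing_tuplesI) auto
  qed
  have "det (kernel_mat n K x y) \<ge> 0"
    if n: "n \<in> {1..p}" and x: "x \<in> increasing_tuples n X" and y: "y \<in> increasing_tuples n Y" for n x y
  proof (cases "(\<forall>i<n. x i \<in> u ` {..<m}) \<and> (\<forall>j<n. y j \<in> v ` {..<m})")
    case True
    then obtain a b where a: "a \<in> increasing_tuples n {..<m}" "\<forall>i<n. x i = u (a i)"
      and b: "b \<in> increasing_tuples n {..<m}" "\<forall>i<n. y i = v (b i)"
      using pull[OF x su] pull[OF y sv] by blast
    have "kernel_mat n K x y = kernel_mat n A a b"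
      using a b by (intro kernel_mat_cong) (simp add: K increasing_tuplesD(1)[of _ n "{..<m}", simplified])
    then show ?thesis using TN_kernelsD[OF A _ _ a(1) b(1)] n by simp
  next
    case False
    then consider i where "i < n" "x i \<notin> u ` {..<m}" | j where "j < n" "y j \<notin> v ` {..<m}" by blast
    then have "det (kernel_mat n K x y) = 0"
    proof cases
      case 1 then show ?thesis by (intro det_kernel_mat_zero_row[of i]) (auto simp: K_def)
    next
      case 2 then show ?thesis by (intro det_kernel_mat_zero_column[of j]) (auto simp: K_def)
    qed
    then show ?thesis by simp
  qed
  then have "K \<in> TN_kernels p X Y" by (simp add: TN_kernels_def)
  then show ?thesis using K by (rule that)
qed

section \<open>Approximation and interpolation by totally positive kernels\<close>

text \<open>Eliminating the first node leaves a Cauchy matrix with row factors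
  \<open>(x - a 0) / (x + b 0)\<close> and column factors \<open>(y - b 0) / (a 0 + y)\<close>,
  which are positive because the nodes increase.\<close>

lemma det_cauchy_kernel_pos:
  fixes a b :: "nat \<Rightarrow> real"
  assumes "\<And>i. i < n \<Longrightarrow> a i > 0" "\<And>i. i < n \<Longrightarrow> b i > 0"
    and "\<And>i j. i < j \<Longrightarrow> j < n \<Longrightarrow> a i < a j" "\<And>i j. i < j \<Longrightarrow> j < n \<Longrightarrow> b i < b j"
  shows "det (kernel_mat n (\<lambda>x y. 1 / (x + y)) a b) > 0"
  using assms
proof (induction n arbitrary: a b)
  case (Suc n)
  let ?f = "\<lambda>x. (x - a 0) / (x + b 0)" and ?g = "\<lambda>y. (y - b 0) / (a 0 + y)"
  have pos: "a i > 0" "b i > 0" if "i < Suc n" for i using Suc.prems that by auto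
  have "kernel_mat n (\<lambda>x y. 1 / (x + y) - 1 / (x + b 0) * (1 / (a 0 + y)) / (1 / (a 0 + b 0)))
        (a \<circ> Suc) (b \<circ> Suc)
      = kernel_mat n (\<lambda>x y. ?f x * ?g y * (1 / (x + y))) (a \<circ> Suc) (b \<circ> Suc)" (is "?l = ?r")
  proof (rule kernel_mat_cong)
    fix i j assume "i < n" "j < n"
    define x where "x = (a \<circ> Suc) i"
    define y where "y = (b \<circ> Suc) j"
    have "x > 0" "y > 0" "a 0 > 0" "b 0 > 0" using pos \<open>i < n\<close> \<open>j < n\<close> by (auto simp: x_def y_def)
    then have "x + y \<noteq> 0" "x + b 0 \<noteq> 0" "a 0 + y \<noteq> 0" "a 0 + b 0 \<noteq> 0" by linarith+
    then have "1 / (x + y) - 1 / (x + b 0) * (1 / (a 0 + y)) / (1 / (a 0 + b 0)) = ?f x * ?g y * (1 / (x + y))"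
      by (simp add: divide_simps) (simp add: algebra_simps)
    then show "1 / ((a \<circ> Suc) i + (b \<circ> Suc) j) -
           1 / ((a \<circ> Suc) i + b 0) * (1 / (a 0 + (b \<circ> Suc) j)) / (1 / (a 0 + b 0)) =
           ?f ((a \<circ> Suc) i) * ?g ((b \<circ> Suc) j) * (1 / ((a \<circ> Suc) i + (b \<circ> Suc) j))"
      unfolding x_def y_def .
  qed
  moreover have "det ?r > 0"
    unfolding det_kernel_mat_scale
  proof (intro mult_pos_pos prod_pos)
    show "det (kernel_mat n (\<lambda>x y. 1 / (x + y)) (a \<circ> Suc) (b \<circ> Suc)) > 0"
      by (rule Suc.IH) (use Suc.prems in auto)
  qed (use pos[of 0] pos Suc.prems(3,4)[of 0] in \<open>auto intro!: divide_pos_pos add_pos_pos\<close>)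
  ultimately show ?case
    using pos[of 0] by (subst det_kernel_mat_schur) auto
qed simp

lemma TP_kernels_cauchy:
  fixes f :: "'a::linorder \<Rightarrow> real" and g :: "'b::linorder \<Rightarrow> real"
  assumes "strict_mono_on X f" "strict_mono_on Y g"
    and "\<And>x. x \<in> X \<Longrightarrow> f x > 0" "\<And>y. y \<in> Y \<Longrightarrow> g y > 0"
  shows "(\<lambda>x y. 1 / (f x + g y)) \<in> TP_kernels p X Y"
  unfolding TP_kernels_def mem_Collect_eq
proof (intro ballI)
  fix n x y assume "x \<in> increasing_tuples n X" "y \<in> increasing_tuples n Y"
  note x = increasing_tuplesD[OF this(1)] and y = increasing_tuplesD[OF this(2)]
  have "det (kernel_mat n (\<lambda>a b. 1 / (a + b)) (f \<circ> x) (g \<circ> y)) > 0"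
    using x y assms by (intro det_cauchy_kernel_pos) (auto simp: strict_mono_onD)
  also have "kernel_mat n (\<lambda>a b. 1 / (a + b)) (f \<circ> x) (g \<circ> y) = kernel_mat n (\<lambda>x y. 1 / (f x + g y)) x y"
    by (rule kernel_mat_cong) simp
  finally show "det (kernel_mat n (\<lambda>x y. 1 / (f x + g y)) x y) > 0" .
qed

text \<open>For \<open>u = exp (r * f x)\<close> and \<open>v = exp (r * g y)\<close> the kernel is
  \<open>2 * u * v / (u\<^sup>2 + v\<^sup>2)\<close>, a rescaled Cauchy kernel.\<close>

lemma TP_kernels_sech:
  fixes f :: "'a::linorder \<Rightarrow> real" and g :: "'b::linorder \<Rightarrow> real"
  assumes "strict_mono_on X f" "strict_mono_on Y g" "r > 0"
  shows "(\<lambda>x y. 1 / cosh (r * (f x - g y))) \<in> TP_kernels p X Y"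
proof -
  have "(\<lambda>x y. 1 / (exp (2 * r * f x) + exp (2 * r * g y))) \<in> TP_kernels p X Y"
    using assms by (intro TP_kernels_cauchy) (auto simp: strict_mono_on_def)
  from TP_kernels_scale[OF this, of "\<lambda>x. 2 * exp (r * f x)" "\<lambda>y. exp (r * g y)"]
  have "(\<lambda>x y. 2 * exp (r * f x) * exp (r * g y) * (1 / (exp (2 * r * f x) + exp (2 * r * g y))))
      \<in> TP_kernels p X Y" by simp
  also have "(\<lambda>x y. 2 * exp (r * f x) * exp (r * g y) * (1 / (exp (2 * r * f x) + exp (2 * r * g y))))
      = (\<lambda>x y. 1 / cosh (r * (f x - g y)))"
  proof (intro ext)
    fix x y
    define u v where "u = exp (r * f x)" and "v = exp (r * g y)"
    have "u > 0" "v > 0" by (auto simp: u_def v_def)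
    moreover have "exp (2 * r * f x) = u\<^sup>2" "exp (2 * r * g y) = v\<^sup>2"
      by (auto simp: u_def v_def power2_eq_square mult_exp_exp)
    moreover have "cosh (r * (f x - g y)) = (u / v + v / u) / 2"
      by (simp add: cosh_field_def u_def v_def exp_diff exp_minus algebra_simps)
    ultimately show "2 * exp (r * f x) * exp (r * g y) * (1 / (exp (2 * r * f x) + exp (2 * r * g y)))
      = 1 / cosh (r * (f x - g y))"
      unfolding u_def[symmetric] v_def[symmetric]
      by (simp add: field_simps power2_eq_square)
  qed
  finally show ?thesis .
qed

text \<open>The sech kernels concentrate on coinciding nodes. The factor is \<open>Suc r\<close>
  because \<open>TP_kernels_sech\<close> asks for a positive parameter.\<close>

lemma tendsto_sech:
  fixes d :: real
  shows "(\<lambda>r::nat. 1 / cosh (real (Suc r) * d)) \<longlonglongrightarrow> (if d = 0 then 1 else 0)"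
proof (cases "d = 0")
  case False
  have "filterlim (\<lambda>r. real (Suc r)) at_top sequentially"
    by (rule filterlim_compose[OF filterlim_real_sequentially filterlim_Suc])
  then have "filterlim (\<lambda>r. \<bar>d\<bar> * real (Suc r)) at_top sequentially"
    using False by (intro filterlim_tendsto_pos_mult_at_top[OF tendsto_const]) auto
  then have lim: "(\<lambda>r. 2 * exp (- (\<bar>d\<bar> * real (Suc r)))) \<longlonglongrightarrow> 2 * 0"
    by (intro tendsto_intros filterlim_compose[OF exp_at_bot] filterlim_compose[OF filterlim_uminus_at_bot_at_top])
  have "1 / cosh (real (Suc r) * d) \<le> 2 * exp (- (\<bar>d\<bar> * real (Suc r)))" for r
  proof -
    have "cosh (real (Suc r) * d) = cosh (\<bar>d\<bar> * real (Suc r))"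
      by (metis abs_mult abs_of_nat cosh_real_abs mult.commute)
    also have "\<dots> \<ge> exp (\<bar>d\<bar> * real (Suc r)) / 2"
      by (simp add: cosh_field_def)
    finally have "1 / cosh (real (Suc r) * d) \<le> 1 / (exp (\<bar>d\<bar> * real (Suc r)) / 2)"
      by (intro divide_left_mono) (auto simp del: of_nat_Suc)
    also have "\<dots> = 2 * exp (- (\<bar>d\<bar> * real (Suc r)))"
      by (simp add: exp_minus inverse_eq_divide del: of_nat_Suc)
    finally show ?thesis by (simp del: of_nat_Suc)
  qed
  then have upper: "\<forall>\<^sub>F r in sequentially. 1 / cosh (real (Suc r) * d) \<le> 2 * exp (- (\<bar>d\<bar> * real (Suc r)))"
    by (intro always_eventually allI)
  have "\<forall>\<^sub>F r in sequentially. 0 \<le> 1 / cosh (real (Suc r) * d)"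
    by (intro always_eventually allI) (simp del: of_nat_Suc)
  from tendsto_sandwich[OF this upper tendsto_const] lim
  have "(\<lambda>r. 1 / cosh (real (Suc r) * d)) \<longlonglongrightarrow> 0" by simp
  then show ?thesis using False by simp
qed simp

text \<open>The sech factors recover \<open>A\<close> at the nodes as \<open>r\<close> grows, while
  the identity block supplies a positive Cauchy-Binet term for each order up to
  \<open>p\<close>.\<close>

lemma TP_kernels_approximate_TN:
  fixes X :: "'a::linorder set" and Y :: "'b::linorder set" and A :: "nat \<Rightarrow> nat \<Rightarrow> real"
    and \<phi> :: "'a \<Rightarrow> real" and \<psi> :: "'b \<Rightarrow> real"
  assumes \<phi>: "strict_mono_on X \<phi>" and \<psi>: "strict_mono_on Y \<psi>"
    and A: "A \<in> TN_kernels p {..<m} {..<m}"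
    and u: "u \<in> increasing_tuples m X" and v: "v \<in> increasing_tuples m Y"
  obtains K where "\<And>r::nat. K r \<in> TP_kernels p X Y"
    "\<And>i j. i < m \<Longrightarrow> j < m \<Longrightarrow> (\<lambda>r. K r (u i) (v j)) \<longlonglongrightarrow> A i j"
proof -
  \<comment> \<open>The middle matrix is indexed by an increasing sequence of reals that continues
    the images of the given nodes; the further members may lie outside the images of
    \<open>X\<close> and \<open>Y\<close>.\<close>
  have nodes: "\<exists>s. strict_mono s \<and> (\<forall>k<m. s k = w k)"
    if w: "\<And>i j. i < j \<Longrightarrow> j < m \<Longrightarrow> w i < w j" for w :: "nat \<Rightarrow> real"
  proof -
    obtain c where c: "\<And>k. k < m \<Longrightarrow> w k < c"
    proof
      show "w k < Max (insert 0 (w ` {..<m})) + 1" if "k < m" for k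
        using Max_ge[of "insert 0 (w ` {..<m})" "w k"] that by (simp add: add_strict_increasing2 le_less_trans[OF _ less_add_one])
    qed
    define s where "s k = (if k < m then w k else c + real k)" for k
    have "strict_mono s"
    proof (rule strict_monoI)
      fix i j :: nat assume "i < j"
      then show "s i < s j" using w[of i j] c[of i] by (auto simp: s_def)
    qed
    then show ?thesis by (auto simp: s_def)
  qed
  note u' = increasing_tuplesD[OF u] and v' = increasing_tuplesD[OF v]
  obtain s where s: "strict_mono s" "\<And>k. k < m \<Longrightarrow> s k = \<phi> (u k)"
    using nodes[of "\<phi> \<circ> u"] u' \<phi> by (auto simp: strict_mono_onD)
  obtain t where t: "strict_mono t" "\<And>k. k < m \<Longrightarrow> t k = \<psi> (v k)"
    using nodes[of "\<psi> \<circ> v"] v' \<psi> by (auto simp: strict_mono_onD)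
  have s_on: "strict_mono_on Z s" and t_on: "strict_mono_on Z t" for Z
    using s(1) t(1) by (auto simp: strict_mono_on_def strict_mono_def)
  \<comment> \<open>The \<open>p\<close> extra indices give \<open>M\<close> an identity submatrix
    of every order up to \<open>p\<close>.\<close>
  define N where "N = m + p"
  define M where "M i j = (if i < m \<and> j < m then A i j else of_bool (i = j))" for i j
  define P where "P r x k = 1 / cosh (real (Suc r) * (\<phi> x - s k))" for r x k
  define Q where "Q r l y = 1 / cosh (real (Suc r) * (t l - \<psi> y))" for r l y
  define R where "R r k y = (\<Sum>l<N. M k l * Q r l y)" for r k y
  define K where "K r x y = (\<Sum>k<N. P r x k * R r k y)" for r x y
  have P: "P r \<in> TP_kernels p X {..<N}" for r
    unfolding P_def using \<phi> s_on by (intro TP_kernels_sech) auto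
  have Q: "Q r \<in> TP_kernels p {..<N} Y" for r
    unfolding Q_def using \<psi> t_on by (intro TP_kernels_sech) auto
  have "M \<in> TN_kernels p {..<N} {..<N}"
    unfolding M_def by (rule TN_kernels_direct_sum_identity[OF A])
  then have R: "R r \<in> TN_kernels p {..<N} Y" for r
    unfolding R_def by (rule TN_kernels_compose[OF _ TP_imp_TN_kernels[OF Q]])
  have "K r \<in> TP_kernels p X Y" for r
    unfolding TP_kernels_def mem_Collect_eq
  proof (intro ballI)
    fix n x y assume n: "n \<in> {1..p}" and x: "x \<in> increasing_tuples n X" and y: "y \<in> increasing_tuples n Y"
    \<comment> \<open>The rows of \<open>M\<close> selected by \<open>w\<close> are unit vectors, so
      there \<open>R r\<close> coincides with the totally positive \<open>Q r\<close>.\<close>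
    define w where "w i = m + i" for i
    have w: "w \<in> increasing_tuples n {..<N}"
      using n by (intro increasing_tuplesI) (auto simp: w_def N_def)
    have "kernel_mat n (R r) w y = kernel_mat n (Q r) w y"
    proof (rule kernel_mat_cong)
      fix i j assume "i < n" "j < n"
      then have "w i < N" using increasing_tuplesD(1)[OF w] by simp
      have "R r (w i) (y j) = (\<Sum>l<N. if l = w i then Q r l (y j) else 0)"
        unfolding R_def by (intro sum.cong) (auto simp: M_def w_def)
      with \<open>w i < N\<close> show "R r (w i) (y j) = Q r (w i) (y j)" by simp
    qed
    then have "det (kernel_mat n (R r) w y) > 0"
      using TP_kernelsD[OF Q _ _ w y] n by simp
    then show "det (kernel_mat n (K r) x y) > 0"
      unfolding K_def using n x y w P
      by (intro det_kernel_compose_pos[where w = w] TN_kernelsD[OF TP_imp_TN_kernels[OF P]]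
            TN_kernelsD[OF R] TP_kernelsD[OF P]) auto
  qed
  moreover have "(\<lambda>r. K r (u i) (v j)) \<longlonglongrightarrow> A i j" if ij: "i < m" "j < m" for i j
  proof -
    \<comment> \<open>At the nodes both sech factors tend to unit vectors, so the double sum tends
      to the single entry \<open>M i j\<close>.\<close>
    have "(\<lambda>r. P r (u i) k) \<longlonglongrightarrow> (if k = i then 1 else 0)" for k
    proof -
      have "\<phi> (u i) - s k = 0 \<longleftrightarrow> k = i"
        using s(2)[OF ij(1)] strict_mono_eq[OF s(1), of i k] by auto
      then show ?thesis using tendsto_sech[of "\<phi> (u i) - s k"] by (simp add: P_def)
    qed
    moreover have "(\<lambda>r. Q r l (v j)) \<longlonglongrightarrow> (if l = j then 1 else 0)" for l
    proof -
      have "t l - \<psi> (v j) = 0 \<longleftrightarrow> l = j"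
        using t(2)[OF ij(2)] strict_mono_eq[OF t(1), of l j] by auto
      then show ?thesis using tendsto_sech[of "t l - \<psi> (v j)"] by (simp add: Q_def)
    qed
    ultimately have "(\<lambda>r. K r (u i) (v j)) \<longlonglongrightarrow>
        (\<Sum>k<N. (if k = i then 1 else 0) * (\<Sum>l<N. M k l * (if l = j then 1 else 0)))"
      unfolding K_def R_def by (intro tendsto_intros)
    also have "(\<Sum>k<N. (if k = i then 1 else 0) * (\<Sum>l<N. M k l * (if l = j then 1 else 0))) = A i j"
    proof -
      have "(\<Sum>l<N. M k l * (if l = j then 1 else 0)) = (\<Sum>l<N. if l = j then M k j else 0)" for k
        by (intro sum.cong) auto
      then have "(\<Sum>l<N. M k l * (if l = j then 1 else 0)) = M k j" for k
        using ij by (simp add: N_def)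
      then have "(\<Sum>k<N. (if k = i then 1 else 0) * (\<Sum>l<N. M k l * (if l = j then 1 else 0)))
          = (\<Sum>k<N. if k = i then M i j else 0)"
        by (intro sum.cong) auto
      then show ?thesis using ij by (simp add: N_def M_def)
    qed
    finally show ?thesis .
  qed
  ultimately show ?thesis by (rule that)
qed

section \<open>Order embeddings into the reals and interpolation of 2x2 matrices\<close>

text \<open>A positive 2x2 minor compares two ratios. The quotient embeds \<open>X\<close> into the
  reals, and that of the transposed kernel embeds \<open>Y\<close>.\<close>

lemma TP_kernels_strict_mono_quotient:
  assumes "K \<in> TP_kernels p X Y" "2 \<le> p" "y1 \<in> Y" "y2 \<in> Y" "y1 < y2"
  shows "strict_mono_on X (\<lambda>x. K x y2 / K x y1)"
proof (rule strict_mono_onI)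
  fix a b assume ab: "a \<in> X" "b \<in> X" "a < b"
  define x y where "x i = (if i = 0 then a else b)" and "y i = (if i = 0 then y1 else y2)" for i :: nat
  have xy: "x \<in> increasing_tuples 2 X" "y \<in> increasing_tuples 2 Y"
    using assms ab by (auto intro!: increasing_tuplesI simp: x_def y_def)
  have "det (kernel_mat 1 K (\<lambda>i. c) (\<lambda>i. y1)) > 0" if "c \<in> X" for c
    using that assms by (intro TP_kernelsD[OF assms(1)]) (auto intro!: increasing_tuplesI)
  then have pos: "K c y1 > 0" if "c \<in> X" for c
    using that unfolding det_kernel_mat_1 by simp
  have "det (kernel_mat 2 K x y) > 0"
    using assms xy by (intro TP_kernelsD[OF assms(1)]) auto
  then have "K a y1 * K b y2 > K a y2 * K b y1"
    by (simp add: det_kernel_mat_2 x_def y_def)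
  then show "K a y2 / K a y1 < K b y2 / K b y1"
    using pos ab by (simp add: field_simps)
qed

text \<open>
  Rescaling rows and columns reduces the claim to prescribing the cross ratio, which for the Cauchy
  kernel with nodes 1, R in both variables is (1 + R)^2 / (4 R).
\<close>

lemma TP_kernels_interpolate_2x2:
  fixes X :: "'a::linorder set" and Y :: "'b::linorder set"
    and \<phi> :: "'a \<Rightarrow> real" and \<psi> :: "'b \<Rightarrow> real"
  assumes \<phi>: "strict_mono_on X \<phi>" and \<psi>: "strict_mono_on Y \<psi>"
    and x: "x1 \<in> X" "x2 \<in> X" "x1 < x2" and y: "y1 \<in> Y" "y2 \<in> Y" "y1 < y2"
    and pos: "a > 0" "b > 0" "c > 0" "d > 0" and det: "a * d > b * c"
  obtains K where "K \<in> TP_kernels p X Y" "K x1 y1 = a" "K x1 y2 = b" "K x2 y1 = c" "K x2 y2 = d"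
proof -
  define \<rho> where "\<rho> = a * d / (b * c)"
  have \<rho>: "\<rho> > 1" using pos det by (simp add: \<rho>_def)
  \<comment> \<open>\<open>R\<close> is the larger root of
    \<open>(1 + R)\<^sup>2 = 4 * \<rho> * R\<close>, which makes \<open>\<rho>\<close> the cross
    ratio of the Cauchy kernel.\<close>
  define q where "q = sqrt (\<rho>\<^sup>2 - \<rho>)"
  define R where "R = 2 * \<rho> - 1 + 2 * q"
  have "q > 0" and q2: "q\<^sup>2 = \<rho>\<^sup>2 - \<rho>" using \<rho> by (auto simp: q_def power2_eq_square)
  then have R: "R > 1" "(1 + R)\<^sup>2 = 4 * \<rho> * R"
    using \<rho> by (auto simp: R_def power2_eq_square algebra_simps)
  \<comment> \<open>Exponential changes of coordinate that move the two nodes to 1 and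
    \<open>R\<close>.\<close>
  define f where "f x = exp (ln R * (\<phi> x - \<phi> x1) / (\<phi> x2 - \<phi> x1))" for x
  define g where "g y = exp (ln R * (\<psi> y - \<psi> y1) / (\<psi> y2 - \<psi> y1))" for y
  have lt: "\<phi> x1 < \<phi> x2" "\<psi> y1 < \<psi> y2" using \<phi> \<psi> x y by (auto simp: strict_mono_onD)
  have fg: "f x1 = 1" "f x2 = R" "g y1 = 1" "g y2 = R"
    using lt R by (auto simp: f_def g_def)
  have "strict_mono_on X f" "strict_mono_on Y g"
    using \<phi> \<psi> lt R unfolding f_def g_def
    by (auto simp: strict_mono_on_def divide_strict_right_mono)
  then have C: "(\<lambda>x y. 1 / (f x + g y)) \<in> TP_kernels p X Y"
    by (rule TP_kernels_cauchy) (auto simp: f_def g_def)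
  \<comment> \<open>These factors are solved from the entries \<open>a\<close>, \<open>b\<close> and
    \<open>c\<close>; the entry \<open>d\<close> is then right because the cross ratio is.\<close>
  define h where "h x = (if x = x1 then 2 * a else c * (1 + R))" for x
  define k where "k y = (if y = y1 then 1 else b * (1 + R) / (2 * a))" for y
  have "(\<lambda>x y. h x * k y * (1 / (f x + g y))) \<in> TP_kernels p X Y"
    using C by (rule TP_kernels_scale) (use pos R in \<open>auto simp: h_def k_def\<close>)
  moreover have "h x2 * k y2 * (1 / (f x2 + g y2)) = d"
  proof -
    have "h x2 * k y2 * (1 / (f x2 + g y2)) = b * c * (1 + R)\<^sup>2 / (4 * a * R)"
      using less_imp_neq[OF x(3)] less_imp_neq[OF y(3)] pos by (simp add: fg h_def k_def power2_eq_square mult_ac)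
    also have "\<dots> = d" unfolding R(2) using pos R(1) by (simp add: \<rho>_def)
    finally show ?thesis .
  qed
  ultimately show ?thesis
    using pos R x y by (intro that[of "\<lambda>x y. h x * k y * (1 / (f x + g y))"])
      (auto simp: fg h_def k_def field_simps)
qed

section \<open>Multiplicative functional equations and inequalities\<close>

text \<open>In logarithmic coordinates this is Cauchy's additive equation, whose monotone solutions
  are linear.\<close>

lemma monotone_multiplicative_imp_powr:
  fixes f :: "real \<Rightarrow> real"
  assumes pos: "\<And>x. x > 0 \<Longrightarrow> f x > 0"
    and mult: "\<And>x y. x > 0 \<Longrightarrow> y > 0 \<Longrightarrow> f (x * y) = f x * f y"
    and mono: "\<And>x y. 0 < x \<Longrightarrow> x \<le> y \<Longrightarrow> f x \<le> f y"
  obtains a where "a \<ge> 0" "\<And>x. x > 0 \<Longrightarrow> f x = x powr a"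
proof -
  define g where "g t = ln (f (exp t))" for t
  have add: "g (s + t) = g s + g t" for s t
    using pos[of "exp s"] pos[of "exp t"] by (simp add: g_def exp_add mult ln_mult)
  have g_mono: "g s \<le> g t" if "s \<le> t" for s t
    using that mono[of "exp s" "exp t"] pos[of "exp s"] by (simp add: g_def)
  have g0: "g 0 = 0" using add[of 0 0] by simp
  have nat: "g (real n * t) = real n * g t" for n t
    by (induction n) (auto simp: g0 add algebra_simps)
  have int: "g (of_int m * t) = of_int m * g t" for m :: int and t
  proof (cases m)
    case (neg n)
    have "g (real (Suc n) * t) + g (- (real (Suc n) * t)) = 0"
      using add[of "real (Suc n) * t" "- (real (Suc n) * t)"] g0 by simp
    then show ?thesis using nat[of "Suc n" t] neg by (simp del: of_nat_Suc)
  qed (simp add: nat)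
  define a where "a = g 1"
  have "a \<ge> 0" using g_mono[of 0 1] g0 by (simp add: a_def)
  have lin: "g t = t * a" for t
  proof -
    \<comment> \<open>Both \<open>g (real n * t)\<close> and \<open>real n * t * a\<close> lie
      between the values of \<open>g\<close> at the integers \<open>m\<close> and
      \<open>m + 1\<close>, which differ by \<open>a\<close>.\<close>
    have "real n * \<bar>g t - t * a\<bar> \<le> a" for n
    proof -
      define m where "m = \<lfloor>real n * t\<rfloor>"
      have m: "of_int m \<le> real n * t" "real n * t \<le> of_int (m + 1)" by (auto simp: m_def)
      have "of_int m * a \<le> real n * g t" "real n * g t \<le> of_int (m + 1) * a"
        using g_mono[OF m(1)] g_mono[OF m(2)] int[of m 1] int[of "m + 1" 1] nat[of n t]
        by (simp_all add: a_def)
      moreover have "of_int m * a \<le> (real n * t) * a" "(real n * t) * a \<le> of_int (m + 1) * a"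
        using m \<open>a \<ge> 0\<close> by (auto intro: mult_right_mono)
      ultimately have "\<bar>real n * (g t - t * a)\<bar> \<le> a"
        by (simp add: abs_le_iff algebra_simps)
      then show ?thesis by (simp add: abs_mult)
    qed
    then have "\<bar>g t - t * a\<bar> = 0"
      using \<open>a \<ge> 0\<close> by (intro real_archimedian_rdiv_eq_0[of _ a]) auto
    then show ?thesis by simp
  qed
  have "f x = x powr a" if "x > 0" for x
  proof -
    have "ln (f x) = ln x * a" using lin[of "ln x"] that by (simp add: g_def)
    then have "exp (ln (f x)) = exp (a * ln x)" by (simp add: mult.commute)
    then show ?thesis using pos[OF that] that by (simp add: powr_def)
  qed
  with \<open>a \<ge> 0\<close> show ?thesis by (rule that)
qed

text \<open>
  In the logarithmic coordinates of g the hypothesis bounds every increment over a step d by every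
  increment over a step 2 d; averaging over a partition of [0, 1] makes g uniformly continuous.
\<close>

lemma strict_multiplicative_imp_isCont:
  fixes F :: "real \<Rightarrow> real"
  assumes pos: "\<And>x. x > 0 \<Longrightarrow> F x > 0"
    and det: "\<And>a b c d. a > 0 \<Longrightarrow> b > 0 \<Longrightarrow> c > 0 \<Longrightarrow> d > 0 \<Longrightarrow> b * c < a * d \<Longrightarrow> F b * F c < F a * F d"
    and "x > 0"
  shows "isCont F x"
proof -
  define g where "g t = ln (F (exp t))" for t
  have g: "g b + g c < g a + g d" if "b + c < a + d" for a b c d
  proof -
    have "F (exp b) * F (exp c) < F (exp a) * F (exp d)"
      using that by (intro det) (simp_all flip: exp_add)
    then have "ln (F (exp b) * F (exp c)) < ln (F (exp a) * F (exp d))"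
      using pos by simp
    then show ?thesis by (simp add: g_def ln_mult_pos pos)
  qed
  have g_mono: "g s \<le> g t" if "s \<le> t" for s t
    using g[of s s t t] that by (cases "s = t") auto
  \<comment> \<open>The factor 2 makes the step strictly shorter than the partition intervals of
    length \<open>1 / real n\<close>, as the strict inequality \<open>g\<close> requires.\<close>
  have step: "real n * (g (t + 1 / (2 * real n)) - g t) \<le> g 1 - g 0" if "n > 0" for n t
  proof -
    have "real n * (g (t + 1 / (2 * real n)) - g t) = (\<Sum>k<n. g (t + 1 / (2 * real n)) - g t)"
      by simp
    also have "\<dots> \<le> (\<Sum>k<n. g (real (Suc k) / real n) - g (real k / real n))"
    proof (rule sum_mono)
      fix k
      have "real k / real n + (t + 1 / (2 * real n)) < real (Suc k) / real n + t"
        using that by (simp add: field_simps)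
      from g[OF this]
      show "g (t + 1 / (2 * real n)) - g t \<le> g (real (Suc k) / real n) - g (real k / real n)" by simp
    qed
    also have "\<dots> = g 1 - g 0"
      using sum_lessThan_telescope[of "\<lambda>k. g (real k / real n)" n] that by simp
    finally show ?thesis .
  qed
  have "isCont g t" for t
    unfolding isCont_def
  proof (rule metric_LIM_I)
    fix e :: real assume "e > 0"
    obtain n where n: "real n * e > g 1 - g 0" using reals_Archimedean3[OF \<open>e > 0\<close>] by blast
    \<comment> \<open>For \<open>n = 0\<close> the choice of \<open>n\<close> would give
      \<open>g 1 < g 0\<close>.\<close>
    have "n > 0" using n g_mono[of 0 1] by (cases n) auto
    have inc: "g (s + 1 / (2 * real n)) - g s < e" for s
    proof -
      have "real n * (g (s + 1 / (2 * real n)) - g s) < real n * e"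
        using step[OF \<open>n > 0\<close>, of s] n by linarith
      then show ?thesis using \<open>n > 0\<close> by (subst (asm) mult_less_cancel_left_pos) auto
    qed
    have "dist (g s) (g t) < e" if "dist s t < 1 / (2 * real n)" for s
    proof (cases "s \<le> t")
      case True
      then show ?thesis
        using g_mono[of s t] g_mono[of t "s + 1 / (2 * real n)"] inc[of s] that by (simp add: dist_real_def)
    next
      case False
      then show ?thesis
        using g_mono[of t s] g_mono[of s "t + 1 / (2 * real n)"] inc[of t] that by (simp add: dist_real_def)
    qed
    then show "\<exists>d>0. \<forall>s. s \<noteq> t \<and> dist s t < d \<longrightarrow> dist (g s) (g t) < e"
      using \<open>n > 0\<close> by (intro exI[of _ "1 / (2 * real n)"]) auto
  qed
  then have "isCont (\<lambda>x. exp (g (ln x))) x"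
    using \<open>x > 0\<close> by (intro continuous_intros isCont_o2[where f = ln and g = g]) auto
  moreover have eq: "\<forall>\<^sub>F y in nhds x. exp (g (ln y)) = F y"
    using eventually_nhds_in_open[of "{0<..}" x] \<open>x > 0\<close>
    by (auto elim!: eventually_mono simp: g_def pos)
  ultimately show ?thesis using isCont_cong[OF eq] by simp
qed

text \<open>For monotone \<open>F\<close> bounded below, the limit from the right at 0 is the
  infimum over the positive reals. Positive sequences are enough since totally positive kernels have
  positive entries.\<close>

lemma tendsto_mono_extension:
  fixes F :: "real \<Rightarrow> real"
  assumes cont: "\<And>x. x > 0 \<Longrightarrow> isCont F x"
    and mono: "\<And>x y. 0 < x \<Longrightarrow> x \<le> y \<Longrightarrow> F x \<le> F y"
    and bdd: "\<And>x. x > 0 \<Longrightarrow> F x \<ge> 0"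
    and s: "s \<longlonglongrightarrow> l" "\<And>r::nat. s r > 0"
  shows "(\<lambda>r. F (s r)) \<longlonglongrightarrow> (if l = 0 then Inf (F ` {0<..}) else F l)"
proof (cases "l = 0")
  case False
  moreover have "l \<ge> 0" using s by (intro LIMSEQ_le_const[OF s(1)]) (auto intro: less_imp_le)
  ultimately have "isCont F l" using cont by simp
  then show ?thesis using False isCont_tendsto_compose s(1) by auto
next
  case True
  define L where "L = Inf (F ` {0<..})"
  have bdd_below: "bdd_below (F ` {0<..})" using bdd by (auto intro: bdd_belowI[of _ 0])
  have "(\<lambda>r. F (s r)) \<longlonglongrightarrow> L"
  proof (rule order_tendstoI)
    fix a assume "a < L"
    also have "L \<le> F (s r)" for r unfolding L_def using s(2) by (intro cInf_lower bdd_below) auto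
    finally show "\<forall>\<^sub>F r in sequentially. a < F (s r)" by (intro always_eventually) auto
  next
    fix a assume "L < a"
    then obtain x where x: "x > 0" "F x < a"
      unfolding L_def using cInf_less_iff[OF _ bdd_below, of a] by auto
    have "\<forall>\<^sub>F r in sequentially. s r < x" using order_tendstoD(2)[OF s(1)] True x by simp
    moreover have "F (s r) < a" if "s r < x" for r using mono[OF s(2), of r x] that x by simp
    ultimately show "\<forall>\<^sub>F r in sequentially. F (s r) < a" by (rule eventually_mono)
  qed
  then show ?thesis using True by (simp add: L_def)
qed

section \<open>Test matrices of size four\<close>

text \<open>Finitely many inequalities in bounded quantifiers that \<open>All_less_Suc\<close>
  unfolds. The order \<open>p\<close> is arbitrary as increasing tuples in \<open>{..<4}\<close>
  have at most four members.\<close>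

lemma TN_kernels_lessThan_4I:
  fixes A :: "nat \<Rightarrow> nat \<Rightarrow> real"
  assumes "\<forall>i<4. \<forall>j<4. A i j \<ge> 0"
    and "\<forall>i2<4. \<forall>i1<i2. \<forall>j2<4. \<forall>j1<j2. A i1 j1 * A i2 j2 - A i1 j2 * A i2 j1 \<ge> 0"
    and "\<forall>i3<4. \<forall>i2<i3. \<forall>i1<i2. \<forall>j3<4. \<forall>j2<j3. \<forall>j1<j2.
      A i1 j1 * (A i2 j2 * A i3 j3 - A i2 j3 * A i3 j2) -
      A i1 j2 * (A i2 j1 * A i3 j3 - A i2 j3 * A i3 j1) +
      A i1 j3 * (A i2 j1 * A i3 j2 - A i2 j2 * A i3 j1) \<ge> 0"
    and "det (kernel_mat 4 A (\<lambda>i. i) (\<lambda>j. j)) \<ge> 0"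
  shows "A \<in> TN_kernels p {..<4} {..<4}"
  unfolding TN_kernels_def mem_Collect_eq
proof (intro ballI)
  fix n and x y :: "nat \<Rightarrow> nat"
  assume n: "n \<in> {1..p}" and "x \<in> increasing_tuples n {..<4}" "y \<in> increasing_tuples n {..<4}"
  note x = increasing_tuplesD[OF this(2)] and y = increasing_tuplesD[OF this(3)]
  \<comment> \<open>A fifth member would have to be at least 4.\<close>
  have bounds: "i \<le> x i" "i \<le> y i" if "i < n" for i
    using that
  proof (induction i)
    case (Suc i)
    case 1 then show ?case using Suc x(2)[of i "Suc i"] by simp
    case 2 then show ?case using Suc y(2)[of i "Suc i"] by simp
  qed simp_all
  have "n \<le> 4" using bounds[of 4] x(1)[of 4] by force
  with n consider "n = 1" | "n = 2" | "n = 3" | "n = 4" by force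
  then show "det (kernel_mat n A x y) \<ge> 0"
  proof cases
    case 1
    then show ?thesis using assms(1) x(1)[of 0] y(1)[of 0] by (simp add: det_kernel_mat_1[simplified])
  next
    case 2
    then show ?thesis using assms(2) x(1)[of 1] y(1)[of 1] x(2)[of 0 1] y(2)[of 0 1]
      by (simp add: det_kernel_mat_2)
  next
    case 3
    then show ?thesis
      using assms(3) x(1)[of 2] y(1)[of 2] x(2)[of 0 1] y(2)[of 0 1] x(2)[of 1 2] y(2)[of 1 2]
      by (simp add: det_kernel_mat_3)
  next
    case 4
    have eq: "x i = i" "y i = i" if "i < 4" for i
    proof -
      have "x 0 < x 1" "x 1 < x 2" "x 2 < x 3" "x 3 < 4" "y 0 < y 1" "y 1 < y 2" "y 2 < y 3" "y 3 < 4"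
        using x y 4 by auto
      moreover have "i = 0 \<or> i = 1 \<or> i = 2 \<or> i = 3" using that by linarith
      ultimately show "x i = i" "y i = i" by auto
    qed
    have "kernel_mat n A x y = kernel_mat 4 A (\<lambda>i. i) (\<lambda>j. j)"
      unfolding 4 by (rule kernel_mat_cong) (simp add: eq)
    then show ?thesis using assms(4) by simp
  qed
qed

text \<open>Values of \<open>!\<close> beyond the length of a list are unspecified, so only indices
  inside the lists carry meaning.\<close>

definition matrix_kernel :: "real list list \<Rightarrow> nat \<Rightarrow> nat \<Rightarrow> real" where
  "matrix_kernel A i j = A ! i ! j"

lemma TN_kernels_2x2:
  fixes a b c d :: real
  assumes "a \<ge> 0" "b \<ge> 0" "c \<ge> 0" "d \<ge> 0" "a * d \<ge> b * c"
  shows "matrix_kernel [[a,b,0,0], [c,d,0,0], [0,0,0,0], [0,0,0,0]] \<in> TN_kernels p {..<4} {..<4}"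
  unfolding matrix_kernel_def
  by (rule TN_kernels_lessThan_4I; (simp only: det_kernel_mat_4 det_kernel_mat_3 o_def insert_index_def)?)
     (use assms in \<open>simp_all add: eval_nat_numeral All_less_Suc\<close>)

text \<open>The leading 3x3 block is singular; raising its entries to the power \<open>a\<close>
  gives determinant \<open>2 powr a - 2\<close>, whose sign bounds \<open>a\<close> from
  below.\<close>

lemma TN_kernels_tridiagonal:
  "matrix_kernel [[1,1,0,0], [1,2,1,0], [0,1,1,0], [0,0,0,0]] \<in> TN_kernels p {..<4} {..<4}"
  unfolding matrix_kernel_def
  by (rule TN_kernels_lessThan_4I; (simp only: det_kernel_mat_4 det_kernel_mat_3 o_def insert_index_def)?)
     (simp_all add: eval_nat_numeral All_less_Suc)

text \<open>
  This matrix E is a sum of two rank one matrices, so 1 + t E has rank 3.  To lowest order in t the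
  determinant of the matrix of powers (1 + t E i j) powr a is a negative multiple of a - 1 if a > 0.
\<close>

definition test_exponents :: "nat \<Rightarrow> nat \<Rightarrow> real" where
  "test_exponents = matrix_kernel [[0,0,0,0], [0,1,2,3], [0,2,4,6], [0,2,5,8]]"

text \<open>The product with the right factor below is \<open>1 + t * test_exponents\<close>. Each
  factor is easy to check: the minors of the right one are non-negative multiples of powers of
  \<open>t\<close>.\<close>

lemma TN_kernels_left_factor:
  "matrix_kernel [[1,0,0,0], [1,1,0,0], [1,2,0,0], [1,2,1,0]] \<in> TN_kernels p {..<4} {..<4}"
  unfolding matrix_kernel_def
  by (rule TN_kernels_lessThan_4I; (simp only: det_kernel_mat_4 det_kernel_mat_3 o_def insert_index_def)?)
     (simp_all add: eval_nat_numeral All_less_Suc)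

lemma TN_kernels_right_factor:
  assumes "t \<ge> 0"
  shows "matrix_kernel [[1,1,1,1], [0,t,2*t,3*t], [0,0,t,2*t], [0,0,0,0]] \<in> TN_kernels p {..<4} {..<4}"
  unfolding matrix_kernel_def
  by (rule TN_kernels_lessThan_4I; (simp only: det_kernel_mat_4 det_kernel_mat_3 o_def insert_index_def)?)
     (use assms in \<open>simp_all add: eval_nat_numeral All_less_Suc algebra_simps\<close>)

lemma TN_kernels_one_plus_test_exponents:
  assumes "t \<ge> 0"
  shows "(\<lambda>i j. 1 + t * test_exponents i j) \<in> TN_kernels p {..<4} {..<4}"
proof (rule TN_kernels_cong[THEN iffD1])
  let ?P = "matrix_kernel [[1,0,0,0], [1,1,0,0], [1,2,0,0], [1,2,1,0]]"
  let ?Q = "matrix_kernel [[1,1,1,1], [0,t,2*t,3*t], [0,0,t,2*t], [0,0,0,0]]"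
  show "(\<lambda>i j. \<Sum>k<4. ?P i k * ?Q k j) \<in> TN_kernels p {..<4} {..<4}"
    by (rule TN_kernels_compose[OF TN_kernels_left_factor TN_kernels_right_factor[OF assms]])
  have "\<forall>i<4. \<forall>j<4. (\<Sum>k<4. ?P i k * ?Q k j) = 1 + t * test_exponents i j"
    by (simp add: eval_nat_numeral All_less_Suc matrix_kernel_def test_exponents_def)
  then show "(\<Sum>k<4. ?P i k * ?Q k j) = 1 + t * test_exponents i j"
    if "i \<in> {..<4}" "j \<in> {..<4}" for i j
    using that by (simp only: lessThan_iff)
qed

text \<open>The exponents are natural numbers, so the determinant is rational and can be evaluated.
  The sign depends on the base: with 2 in place of \<open>5 / 4\<close> the value would be
  480.\<close>

lemma det_test_exponents_neg:
  "det (kernel_mat 4 (\<lambda>i j. (5 / 4) powr test_exponents i j) (\<lambda>i. i) (\<lambda>j. j)) < 0"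
  unfolding det_kernel_mat_4 det_kernel_mat_3
  by (simp add: insert_index_def test_exponents_def matrix_kernel_def eval_nat_numeral)

section \<open>Preservers\<close>

lemma powr_preserves_TN_imp_le_one:
  assumes "4 \<le> p"
    and pres: "\<And>A. A \<in> TN_kernels p {..<4} {..<4} \<Longrightarrow>
      comp_op (\<lambda>x. x powr a) A \<in> TN_kernels p {..<4::nat} {..<4::nat}"
  shows "a \<le> 1"
proof (rule ccontr)
  assume "\<not> a \<le> 1"
  then have "a > 1" by simp
  \<comment> \<open>Non-negativity is asked at all indices because the base case uses
    \<open>x powr 1 = x\<close> for an equality of functions.\<close>
  have iter: "comp_op (\<lambda>x. x powr (a ^ k)) A \<in> TN_kernels p {..<4} {..<4}"
    if "A \<in> TN_kernels p {..<4} {..<4}" "\<And>i j. A i j \<ge> 0" for k and A :: "nat \<Rightarrow> nat \<Rightarrow> real"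
  proof (induction k)
    case 0 show ?case using that by (simp add: comp_op_def)
  next
    case (Suc k)
    from pres[OF this] show ?case
      by (simp add: comp_op_def powr_powr mult.commute)
  qed
  \<comment> \<open>Cut off to 0 outside the block, where \<open>test_exponents\<close> is
    unspecified, so that \<open>iter\<close> applies.\<close>
  define E where "E i j = test_exponents i j * of_bool (i < 4 \<and> j < 4)" for i j
  have "\<forall>i<4. \<forall>j<4. test_exponents i j \<ge> 0"
    by (simp add: test_exponents_def matrix_kernel_def eval_nat_numeral All_less_Suc)
  then have E: "E i j \<ge> 0" for i j by (simp add: E_def)
  define l where "l = ln (5 / 4 :: real)"
  have "l > 0" by (simp add: l_def)
  \<comment> \<open>Its power with exponent \<open>n = a ^ k\<close> has entries
    \<open>(1 + z / n) powr n\<close> with \<open>z = l * E i j\<close>. As \<open>a > 1\<close>,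
    these tend to \<open>exp z\<close>, a power of \<open>5 / 4\<close> by the choice of
    \<open>l\<close>.\<close>
  define B where "B k i j = 1 + l / a ^ k * E i j" for k i j
  have "B k \<in> TN_kernels p {..<4} {..<4}" for k
  proof -
    have "(\<lambda>i j. 1 + l / a ^ k * test_exponents i j) \<in> TN_kernels p {..<4} {..<4}"
      using \<open>l > 0\<close> \<open>a > 1\<close> by (intro TN_kernels_one_plus_test_exponents) simp
    then show ?thesis by (rule TN_kernels_cong[THEN iffD1, rotated]) (simp add: B_def E_def)
  qed
  moreover have "B k i j \<ge> 0" for k i j
    using E \<open>l > 0\<close> \<open>a > 1\<close> by (simp add: B_def)
  ultimately have "comp_op (\<lambda>x. x powr (a ^ k)) (B k) \<in> TN_kernels p {..<4} {..<4}" for k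
    by (rule iter)
  from TN_kernelsD[OF this, of 4 "\<lambda>i. i" "\<lambda>j. j"]
  have nonneg: "det (kernel_mat 4 (comp_op (\<lambda>x. x powr (a ^ k)) (B k)) (\<lambda>i. i) (\<lambda>j. j)) \<ge> 0" for k
    using \<open>4 \<le> p\<close> by (simp add: increasing_tuples_id)
  have "filterlim (\<lambda>k. a ^ k) at_top sequentially"
    using filterlim_realpow_sequentially_gt1[of a] \<open>a > 1\<close>
    by (auto simp: filterlim_at_infinity_conv_norm_at_top norm_power)
  then have "(\<lambda>k. comp_op (\<lambda>x. x powr (a ^ k)) (B k) i j) \<longlonglongrightarrow> (5 / 4) powr test_exponents i j"
    if "i < 4" "j < 4" for i j
    using filterlim_compose[OF tendsto_exp_limit_at_top[of "l * test_exponents i j"]] that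
    by (simp add: comp_op_def B_def E_def l_def powr_def[of "5/4"] mult.commute)
  then have "(\<lambda>k. det (kernel_mat 4 (comp_op (\<lambda>x. x powr (a ^ k)) (B k)) (\<lambda>i. i) (\<lambda>j. j))) \<longlonglongrightarrow>
      det (kernel_mat 4 (\<lambda>i j. (5 / 4) powr test_exponents i j) (\<lambda>i. i) (\<lambda>j. j))"
    by (intro tendsto_det_kernel_mat)
  then have "det (kernel_mat 4 (\<lambda>i j. (5 / 4) powr test_exponents i j) (\<lambda>i. i) (\<lambda>j. j)) \<ge> 0"
    by (rule LIMSEQ_le_const) (use nonneg in auto)
  then show False using det_test_exponents_neg by simp
qed

lemma preserves_TN_4x4_imp_const_or_linear:
  fixes F :: "real \<Rightarrow> real"
  assumes "4 \<le> p"
    and pres: "\<And>A. A \<in> TN_kernels p {..<4} {..<4} \<Longrightarrow> comp_op F A \<in> TN_kernels p {..<4::nat} {..<4::nat}"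
  shows "\<exists>c\<ge>0. (\<forall>x\<ge>0. F x = c) \<or> (\<forall>x\<ge>0. F x = c * x)"
proof -
  have two: "F a * F d \<ge> F b * F c" and nonneg: "F a \<ge> 0"
    if "a \<ge> 0" "b \<ge> 0" "c \<ge> 0" "d \<ge> 0" "a * d \<ge> b * c" for a b c d
  proof -
    note K = pres[OF TN_kernels_2x2[OF that]]
    show "F a \<ge> 0"
      using TN_kernels_nonneg[OF K, of 0 0] \<open>4 \<le> p\<close> by (simp add: comp_op_def matrix_kernel_def)
    show "F a * F d \<ge> F b * F c"
      using TN_kernelsD[OF K, of 2 "\<lambda>i. i" "\<lambda>j. j"] \<open>4 \<le> p\<close>
      by (simp add: increasing_tuples_id det_kernel_mat_2 comp_op_def matrix_kernel_def)
  qed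
  have nonneg: "F a \<ge> 0" if "a \<ge> 0" for a using nonneg[of a 0 0 0] that by simp
  \<comment> \<open>When the products agree, the matrix with its columns swapped satisfies the same
    hypotheses.\<close>
  have eq: "F a * F d = F b * F c" if "a \<ge> 0" "b \<ge> 0" "c \<ge> 0" "d \<ge> 0" "a * d = b * c" for a b c d
    using two[of a b c d] two[of b a d c] that by simp
  have mono: "F x \<le> F y" if "0 \<le> x" "x \<le> y" for x y
  proof -
    have "F x * F x \<le> F y * F y" using two[of y x x y] mult_mono[of x y x y] that by simp
    then show ?thesis using nonneg[of y] that power2_le_imp_le[of "F x" "F y"] by (simp add: power2_eq_square)
  qed
  show ?thesis
  proof (cases "F 1 = 0")
    case True
    \<comment> \<open>From \<open>x * x = (x * x) * 1\<close> it follows that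
      \<open>F x * F x = F (x * x) * F 1\<close>.\<close>
    have "F x = 0" if "x \<ge> 0" for x using eq[of x "x * x" 1 x] that True by simp
    then show ?thesis by auto
  next
    case False
    then have F1: "F 1 > 0" using nonneg[of 1] by simp
    show ?thesis
    proof (cases "F 0 = 0")
      case False
      \<comment> \<open>From \<open>0 * x = 0 * 1\<close>, after cancelling
        \<open>F 0\<close>.\<close>
      have "F x = F 1" if "x \<ge> 0" for x using eq[of 0 0 1 x] that False by simp
      then show ?thesis using less_imp_le[OF F1] by blast
    next
      case True
      define f where "f x = F x / F 1" for x
      have mult: "f (x * y) = f x * f y" if "x > 0" "y > 0" for x y
        using eq[of x "x * y" 1 y] that F1 by (simp add: f_def field_simps)
      have "f x > 0" if "x > 0" for x
        using mult[of x "1 / x"] nonneg[of x] F1 that by (auto simp: f_def order.order_iff_strict)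
      moreover have "f x \<le> f y" if "0 < x" "x \<le> y" for x y
        using mono[of x y] that F1 by (simp add: f_def divide_right_mono)
      ultimately obtain a where a: "a \<ge> 0" "\<And>x. x > 0 \<Longrightarrow> f x = x powr a"
        using mult monotone_multiplicative_imp_powr[of f] by metis
      \<comment> \<open>This covers \<open>x = 0\<close>, since \<open>0 powr a = 0\<close> for
        every \<open>a\<close>, even for \<open>a = 0\<close>.\<close>
      have F: "F x = F 1 * x powr a" if "x \<ge> 0" for x
        using a(2)[of x] that F1 True by (cases "x = 0") (auto simp: f_def field_simps)
      have "a \<le> 1"
      proof (rule powr_preserves_TN_imp_le_one[OF \<open>4 \<le> p\<close>])
        fix A :: "nat \<Rightarrow> nat \<Rightarrow> real" assume A: "A \<in> TN_kernels p {..<4} {..<4}"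
        have *: "(1 / F 1) * F (A i j) = A i j powr a" if "i < 4" "j < 4" for i j
          using TN_kernels_nonneg[OF A, of i j] that \<open>4 \<le> p\<close> F1 F[of "A i j"] by simp
        have "(\<lambda>i j. (1 / F 1) * comp_op F A i j) \<in> TN_kernels p {..<4} {..<4}"
          using F1 by (intro TN_kernels_cmult pres A) simp
        then show "comp_op (\<lambda>x. x powr a) A \<in> TN_kernels p {..<4} {..<4}"
          by (rule TN_kernels_cong[THEN iffD1, rotated]) (use * in \<open>simp add: comp_op_def\<close>)
      qed
      moreover have "a \<ge> 1"
      proof -
        have "det (kernel_mat 3 (comp_op F (matrix_kernel [[1,1,0,0], [1,2,1,0], [0,1,1,0], [0,0,0,0]]))
            (\<lambda>i. i) (\<lambda>j. j)) \<ge> 0"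
          using TN_kernelsD[OF pres[OF TN_kernels_tridiagonal], of 3 "\<lambda>i. i" "\<lambda>j. j"] \<open>4 \<le> p\<close>
          by (simp add: increasing_tuples_id)
        then have "F 1 * (F 2 * F 1 - F 1 * F 1) - F 1 * (F 1 * F 1) \<ge> 0"
          unfolding det_kernel_mat_3 by (simp add: comp_op_def matrix_kernel_def True eval_nat_numeral)
        then have "F 1 * F 1 * (F 2 - 2 * F 1) \<ge> 0" by (simp add: algebra_simps)
        then have "F 2 \<ge> 2 * F 1" using F1 mult_pos_pos[OF F1 F1] by (auto simp: zero_le_mult_iff)
        then have "2 powr 1 \<le> (2::real) powr a" using F[of 2] F1 by simp
        then show ?thesis by (simp only: powr_le_cancel_iff)
      qed
      ultimately have "F x = F 1 * x" if "x \<ge> 0" for x using F[OF that] that by simp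
      then show ?thesis using less_imp_le[OF F1] by blast
    qed
  qed
qed

section \<open>Preservers of totally positive kernels\<close>

lemma preserves_TP_imp_linear:
  fixes X :: "'a::linorder set" and Y :: "'b::linorder set" and F :: "real \<Rightarrow> real"
  assumes "4 \<le> p" and u: "u \<in> increasing_tuples 4 X" and v: "v \<in> increasing_tuples 4 Y"
    and K0: "K0 \<in> TP_kernels p X Y"
    and pres: "\<And>K. K \<in> TP_kernels p X Y \<Longrightarrow> comp_op F K \<in> TP_kernels p X Y"
  shows "\<exists>c>0. \<forall>x>0. F x = c * x"
proof -
  note u' = increasing_tuplesD[OF u] and v' = increasing_tuplesD[OF v]
  define \<phi> where "\<phi> x = K0 x (v 1) / K0 x (v 0)" for x
  define \<psi> where "\<psi> y = K0 (u 1) y / K0 (u 0) y" for y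
  have \<phi>: "strict_mono_on X \<phi>"
    unfolding \<phi>_def using \<open>4 \<le> p\<close> v' by (intro TP_kernels_strict_mono_quotient[OF K0]) auto
  have \<psi>: "strict_mono_on Y \<psi>"
    unfolding \<psi>_def using \<open>4 \<le> p\<close> u'
    by (intro TP_kernels_strict_mono_quotient[OF TP_kernels_transpose[OF K0]]) auto
  have pos: "F a > 0" and det: "F b * F c < F a * F d"
    if "a > 0" "b > 0" "c > 0" "d > 0" "b * c < a * d" for a b c d
  proof -
    note abcd = that
    have uv: "u 0 \<in> X" "u 1 \<in> X" "u 0 < u 1" "v 0 \<in> Y" "v 1 \<in> Y" "v 0 < v 1"
      using u' v' by simp_all
    obtain K where K: "K \<in> TP_kernels p X Y"
      "K (u 0) (v 0) = a" "K (u 0) (v 1) = b" "K (u 1) (v 0) = c" "K (u 1) (v 1) = d"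
      by (rule TP_kernels_interpolate_2x2[OF \<phi> \<psi> uv abcd])
    show "F a > 0"
      using TP_kernels_pos[OF pres[OF K(1)], of "u 0" "v 0"] \<open>4 \<le> p\<close> u' v' K by (simp add: comp_op_def)
    have "u \<in> increasing_tuples 2 X" "v \<in> increasing_tuples 2 Y"
      using u' v' by (auto intro!: increasing_tuplesI)
    then show "F b * F c < F a * F d"
      using TP_kernelsD[OF pres[OF K(1)], of 2 u v] \<open>4 \<le> p\<close> K
      by (simp add: det_kernel_mat_2 comp_op_def)
  qed
  \<comment> \<open>The 2x2 matrix with entries \<open>a\<close>, \<open>a\<close>,
    \<open>a\<close>, \<open>2 * a\<close> has positive determinant, so every positive
    \<open>a\<close> occurs as an entry.\<close>
  have pos: "F a > 0" if "a > 0" for a using pos[of a a a "2 * a"] that by simp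
  have smono: "F x < F y" if "0 < x" "x < y" for x y
  proof -
    have "F x * F x < F y * F y" using det[of y x x y] that by (simp add: mult_strict_mono)
    then show ?thesis using pos[of y] that power2_less_imp_less[of "F x" "F y"] by (simp add: power2_eq_square)
  qed
  \<comment> \<open>The continuous extension of \<open>F\<close> to 0, where the limit matrix
    \<open>A\<close> may have entries.\<close>
  define G where "G x = (if x = 0 then Inf (F ` {0<..}) else F x)" for x
  have lim: "(\<lambda>r. F (s r)) \<longlonglongrightarrow> G l" if "s \<longlonglongrightarrow> l" "\<And>r::nat. s r > 0" for s l
    unfolding G_def
  proof (rule tendsto_mono_extension[OF _ _ _ that])
    show "isCont F x" if "x > 0" for x
      by (rule strict_multiplicative_imp_isCont[OF pos det that])
    show "F x \<le> F y" if "0 < x" "x \<le> y" for x y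
      using smono[of x y] that by (cases "x = y") auto
    show "F x \<ge> 0" if "x > 0" for x using pos[OF that] by simp
  qed
  have "comp_op G A \<in> TN_kernels p {..<4} {..<4}" if A: "A \<in> TN_kernels p {..<4::nat} {..<4::nat}" for A
  proof -
    obtain K where K: "\<And>r::nat. K r \<in> TP_kernels p X Y"
      "\<And>i j. i < 4 \<Longrightarrow> j < 4 \<Longrightarrow> (\<lambda>r. K r (u i) (v j)) \<longlonglongrightarrow> A i j"
      by (rule TP_kernels_approximate_TN[OF \<phi> \<psi> A u v]) (rule that)
    have "det (kernel_mat n (comp_op G A) x y) \<ge> 0"
      if n: "n \<in> {1..p}" and x: "x \<in> increasing_tuples n {..<4}" and y: "y \<in> increasing_tuples n {..<4}" for n x y
    proof -
      note x' = increasing_tuplesD(1)[OF x] and y' = increasing_tuplesD(1)[OF y]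
      have ux: "u \<circ> x \<in> increasing_tuples n X" and vy: "v \<circ> y \<in> increasing_tuples n Y"
        using increasing_tuples_comp_index[OF u x] increasing_tuples_comp_index[OF v y] by simp_all
      have "(\<lambda>r. det (kernel_mat n (comp_op F (K r)) (u \<circ> x) (v \<circ> y))) \<longlonglongrightarrow> det (kernel_mat n (comp_op G A) x y)"
      proof (rule tendsto_det_kernel_mat)
        fix i j assume "i < n" "j < n"
        then have *: "x i < 4" "y j < 4" using x' y' by auto
        show "(\<lambda>r. comp_op F (K r) ((u \<circ> x) i) ((v \<circ> y) j)) \<longlonglongrightarrow> comp_op G A (x i) (y j)"
          unfolding comp_op_def o_def
        proof (rule lim[OF K(2)[OF *]])
          show "K r (u (x i)) (v (y j)) > 0" for r
            using TP_kernels_pos[OF K(1)] u'(1)[OF *(1)] v'(1)[OF *(2)] \<open>4 \<le> p\<close> by simp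
        qed
      qed
      moreover have "det (kernel_mat n (comp_op F (K r)) (u \<circ> x) (v \<circ> y)) > 0" for r
        using TP_kernelsD[OF pres[OF K(1)] _ _ ux vy] n by simp
      ultimately show ?thesis by (intro LIMSEQ_le_const) (auto intro: less_imp_le)
    qed
    then show ?thesis by (simp add: TN_kernels_def)
  qed
  from preserves_TN_4x4_imp_const_or_linear[OF \<open>4 \<le> p\<close> this]
  obtain c where "(\<forall>x\<ge>0. G x = c) \<or> (\<forall>x\<ge>0. G x = c * x)" by blast
  moreover have "\<not> (\<forall>x\<ge>0. G x = c)"
  proof
    assume const: "\<forall>x\<ge>0. G x = c"
    have "G 1 = G 2" using const[rule_format, of 1] const[rule_format, of 2] by linarith
    then show False using smono[of 1 2] by (simp add: G_def)
  qed
  ultimately have lin: "G x = c * x" if "x > 0" for x using that by simp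
  have "F x = c * x" if "x > 0" for x using lin[OF that] that by (simp add: G_def)
  moreover from this[of 1] have "c > 0" using pos[of 1] by simp
  ultimately show ?thesis by blast
qed

theorem theorem1p1:
  fixes X :: "'a::linorder set" and Y :: "'b::linorder set"
    and F :: "real \<Rightarrow> real" and p :: nat
  assumes "infinite X \<or> 4 \<le> card X"
    and "infinite Y \<or> 4 \<le> card Y"
    and "4 \<le> p"
  shows "(comp_op F ` TN_kernels p X Y \<subseteq> TN_kernels p X Y \<longleftrightarrow>
            (\<exists>c\<ge>0. (\<forall>x\<ge>0. F x = c) \<or> (\<forall>x\<ge>0. F x = c * x))) \<and>
         (TP_kernels p X Y \<noteq> {} \<longrightarrow>
           (comp_op F ` TP_kernels p X Y \<subseteq> TP_kernels p X Y \<longleftrightarrow>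
            (\<exists>c>0. \<forall>x>0. F x = c * x)))"
proof -
  obtain u v where u: "u \<in> increasing_tuples 4 X" and v: "v \<in> increasing_tuples 4 Y"
    using increasing_tuples_exists assms(1,2) by metis
  have "\<exists>c\<ge>0. (\<forall>x\<ge>0. F x = c) \<or> (\<forall>x\<ge>0. F x = c * x)"
    if pres: "comp_op F ` TN_kernels p X Y \<subseteq> TN_kernels p X Y"
  proof (rule preserves_TN_4x4_imp_const_or_linear[OF \<open>4 \<le> p\<close>])
    fix A :: "nat \<Rightarrow> nat \<Rightarrow> real" assume A: "A \<in> TN_kernels p {..<4} {..<4}"
    \<comment> \<open>The minors of \<open>comp_op F A\<close> are those of
      \<open>comp_op F K\<close> at the nodes, whatever \<open>F\<close> makes of the zeros
      elsewhere.\<close>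
    obtain K where K: "K \<in> TN_kernels p X Y" "\<And>i j. i < 4 \<Longrightarrow> j < 4 \<Longrightarrow> K (u i) (v j) = A i j"
      by (rule TN_kernels_extend_by_zero[OF A u v]) (rule that)
    have "det (kernel_mat n (comp_op F A) x y) \<ge> 0"
      if n: "n \<in> {1..p}" and x: "x \<in> increasing_tuples n {..<4}" and y: "y \<in> increasing_tuples n {..<4}" for n x y
    proof -
      have "u \<circ> x \<in> increasing_tuples n X" "v \<circ> y \<in> increasing_tuples n Y"
        using increasing_tuples_comp_index[OF u x] increasing_tuples_comp_index[OF v y] by simp_all
      then have "det (kernel_mat n (comp_op F K) (u \<circ> x) (v \<circ> y)) \<ge> 0"
        using pres K(1) n by (intro TN_kernelsD) auto
      also have "kernel_mat n (comp_op F K) (u \<circ> x) (v \<circ> y) = kernel_mat n (comp_op F A) x y"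
        using increasing_tuplesD(1)[OF x] increasing_tuplesD(1)[OF y]
        by (intro kernel_mat_cong) (simp add: comp_op_def K(2))
      finally show ?thesis .
    qed
    then show "comp_op F A \<in> TN_kernels p {..<4} {..<4}" by (simp add: TN_kernels_def)
  qed
  moreover have "comp_op F K \<in> TN_kernels p X Y"
    if c: "c \<ge> 0" "(\<forall>x\<ge>0. F x = c) \<or> (\<forall>x\<ge>0. F x = c * x)" and K: "K \<in> TN_kernels p X Y" for c K
  proof -
    have nonneg: "K x y \<ge> 0" if "x \<in> X" "y \<in> Y" for x y
      using TN_kernels_nonneg[OF K _ that] \<open>4 \<le> p\<close> by simp
    \<comment> \<open>\<open>F\<close> is prescribed for non-negative arguments and \<open>K\<close>
      is non-negative on \<open>X\<close> and \<open>Y\<close> only, so the comparison with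
      \<open>L\<close> holds there and is transferred by congruence.\<close>
    from c(2) obtain L where L: "L \<in> TN_kernels p X Y" "\<And>x y. x \<in> X \<Longrightarrow> y \<in> Y \<Longrightarrow> comp_op F K x y = L x y"
    proof
      assume "\<forall>x\<ge>0. F x = c"
      then show thesis using nonneg that[OF TN_kernels_const[OF c(1)]] by (simp add: comp_op_def)
    next
      assume "\<forall>x\<ge>0. F x = c * x"
      then show thesis using nonneg that[OF TN_kernels_cmult[OF K c(1)]] by (simp add: comp_op_def)
    qed
    from L(1) show ?thesis by (rule TN_kernels_cong[THEN iffD2, rotated]) (rule L(2))
  qed
  moreover have "\<exists>c>0. \<forall>x>0. F x = c * x"
    if "TP_kernels p X Y \<noteq> {}" "comp_op F ` TP_kernels p X Y \<subseteq> TP_kernels p X Y"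
    using that preserves_TP_imp_linear[OF \<open>4 \<le> p\<close> u v] by blast
  moreover have "comp_op F K \<in> TP_kernels p X Y"
    if c: "c > 0" "\<forall>x>0. F x = c * x" and K: "K \<in> TP_kernels p X Y" for c K
  proof -
    have eq: "comp_op F K x y = c * 1 * K x y" if "x \<in> X" "y \<in> Y" for x y
      using TP_kernels_pos[OF K _ that] \<open>4 \<le> p\<close> c(2) by (simp add: comp_op_def)
    have "(\<lambda>x y. c * 1 * K x y) \<in> TP_kernels p X Y"
      using c(1) by (intro TP_kernels_scale[OF K]) auto
    then show ?thesis by (rule TP_kernels_cong[THEN iffD2, rotated]) (rule eq)
  qed
  ultimately show ?thesis by blast
qed

end
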